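(* For any (continuously differentiable) function $f(a,b)$, the following identity holds when it is viewed as a formal power series in $x$: $$\big(f(x,s)-f(0,s)\big) + \Big(\frac{2s}{1+\exp(x\partial_b)}\Big|_{b=s}\Big)\circ\Big({-}\frac{f(x,-b)+f(x,b)}{2b}+\frac{f(0,-b)+f(0,b)}{2b}\Big)$$ $$= \mathcal{D}_1\circ\big(b\,f(a+b,a)+a\,f(a+b,b)\big) + \mathcal{D}_2\circ f(0,b) + \mathcal{D}_3\circ\big(\partial_b(f(0,b)-f(0,-b))\big),$$ where $\mathcal{D}_1,\mathcal{D}_2,\mathcal{D}_3$ are the differential operators defined in the context.
   Context: **Formal Laplace transform.** For a formal power series $F = \sum_{n\ge0}\lambda_n(y,\partial_a,\partial_b)x^n \in \mathbb{Q}[y,\partial_a,\partial_b][[x]]$ in $x$, whose coefficients are polynomials in $y$ and the differentials $\partial_a=\partial/\partial a$, $\partial_b=\partial/\partial b$, put $\mathscr{L}_y\{F\}(s) = \sum_{n\ge0} \mathscr{L}_y\{\lambda_n(y,\partial_a,\partial_b)\}(s)\,x^n \in \mathbb{Q}[s^{-1},\partial_a,\partial_b][[x]]$, where on polynomials in $y$ the transform is the usual Laplace transform $\mathscr{L}_y\{h(y)\}(s)=\int_0^\infty h(y)e^{-sy}\,dy$, so $\mathscr{L}_y\{y^n\}(s) = n!/s^{n+1}$ (extended linearly over $\mathbb{Q}[\partial_a,\partial_b]$). **Operators.** With the functions inside $\mathscr{L}_y$ regarded as elements of $\mathbb{Q}[y,\partial_a,\partial_b][[x]]$, $$\mathcal{D}_1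 = s\cdot\mathscr{L}_y\Big\{ \tfrac{y}{2} - \tfrac12(\partial_a-\partial_b)\tanh\big(\tfrac{xy}{2}\big) - \tfrac14 xy(\partial_a-\partial_b)\,\mathrm{sech}^2\big(\tfrac{xy}{2}\big) + \tfrac12 y\,\mathrm{sech}\big(\tfrac{xy}{2}\big)\sinh\big(\tfrac12x(\partial_a-\partial_b)\big)\,\mathrm{sech}\big(\tfrac12x(\partial_a-\partial_b+y)\big) - \tfrac1x\sinh\big(\tfrac{xy}{2}\big)\exp\big(\tfrac12x(\partial_a+\partial_b)\big)\,\mathrm{sech}\big(\tfrac12x(\partial_a-\partial_b+y)\big)\Big\}(s)\Big|_{a=-s,\,b=s},$$ $$\mathcal{D}_2 = s\cdot\mathscr{L}_y\Big\{\tanh\Big(\frac{x(y-\partial_b)}{2}\Big)\Big\}(s)\Big|_{b=s},\qquad \mathcal{D}_3 = s\cdot\mathscr{L}_y\Big\{-\tfrac14x\Big(-2+xy\tanh\big(\tfrac{xy}{2}\big)\Big)\mathrm{sech}^2\big(\tfrac{xy}{2}\big)\Big\}(s)\Big|_{b=s}.$$ **Action.** A differential operator $\mathcal{E}=\sum_{n\ge0}\mu_n(s,\partial_a,\partial_b)x^n$, with coefficients polynomial in $\partial_a,\partial_b$ (and in $s^{\pm1}$), acts on a function $g=g(a,b,x)$ as the formal power series $\mathcal{E}\circ g=\sum_{n\ge0}(\mu_n(s,\partial_a,\partial_b)\circ g)\,x^n$. When the operator contains a substitution (written $|_{a=-s,b=s}$ or $|_{b=s}$), the substitution is carried out after the derivatives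 are applied. The operator $\frac{2s}{1+\exp(x\partial_b)}\big|_{b=s}$ is understood in the same way, through the expansion $\frac{2}{1+\exp(x\partial_b)}=\sum_{i\ge0}\frac{E_i(0)}{i!}x^i\partial_b^i$, where the Euler polynomials $E_i(z)$ are defined by $\sum_{j\ge0} E_j(z)\frac{t^j}{j!}=\frac{2e^{tz}}{1+e^t}$.
   Formalization: "Continuously differentiable" is read as infinitely often continuously differentiable on the whole plane, because both sides contain partial derivatives of f of every order, which need not exist for a function that is only once continuously differentiable. *)

theory Defs
  imports "HOL-Analysis.Analysis" "HOL-Computational_Algebra.Formal_Power_Series"
begin

definition pda :: "(real \<Rightarrow> real \<Rightarrow> real) \<Rightarrow> real \<Rightarrow> real \<Rightarrow> real" where
  "pda g = (\<lambda>a b. deriv (\<lambda>t. g t b) a)"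

definition pdb :: "(real \<Rightarrow> real \<Rightarrow> real) \<Rightarrow> real \<Rightarrow> real \<Rightarrow> real" where
  "pdb g = (\<lambda>a b. deriv (\<lambda>t. g a t) b)"

text \<open>
  The operators below contain derivatives of every order, so ``continuously differentiable''
  functions have to be so infinitely often: all iterated partial derivatives exist and are
  jointly continuous.
\<close>

primrec C_diff :: "nat \<Rightarrow> (real \<Rightarrow> real \<Rightarrow> real) \<Rightarrow> bool" where
  "C_diff 0 g \<longleftrightarrow> continuous_on UNIV (\<lambda>p. g (fst p) (snd p))"
| "C_diff (Suc k) g \<longleftrightarrow>
     (\<forall>a b. (\<lambda>t. g t b) differentiable (at a) \<and> (\<lambda>t. g a t) differentiable (at b)) \<and>
     C_diff k (pda g) \<and> C_diff k (pdb g)"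

definition smooth2 :: "(real \<Rightarrow> real \<Rightarrow> real) \<Rightarrow> bool" where
  "smooth2 g \<longleftrightarrow> (\<forall>k. C_diff k g)"

definition taylor :: "(real \<Rightarrow> real) \<Rightarrow> real fps" where
  "taylor h = Abs_fps (\<lambda>k. (deriv ^^ k) h 0 / fact k)"

definition fps_sinh :: "real fps" where
  "fps_sinh = fps_const (1/2) * (fps_exp 1 - fps_exp (-1))"

definition fps_cosh :: "real fps" where
  "fps_cosh = fps_const (1/2) * (fps_exp 1 + fps_exp (-1))"

definition fps_tanh :: "real fps" where
  "fps_tanh = fps_sinh / fps_cosh"

definition fps_sech :: "real fps" where
  "fps_sech = 1 / fps_cosh"

definition euler_poly :: "nat \<Rightarrow> real \<Rightarrow> real" where
  "euler_poly i z = fact i * fps_nth (2 * fps_exp z / (1 + fps_exp 1)) i"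

text \<open>
  Polynomials in \<open>\<partial>\<^sub>a\<close>, \<open>\<partial>\<^sub>b\<close> are nested: the outer variable of \<open>dpoly\<close> is \<open>\<partial>\<^sub>a\<close>,
  the inner one is \<open>\<partial>\<^sub>b\<close>.  In \<open>ypoly\<close> the variable \<open>y\<close> is added as the outermost one.
  Scalars are real rather than rational, so that the result of a Laplace transform
  can be evaluated at a real number \<open>s\<close>.
\<close>

type_synonym dpoly = "real poly poly"
type_synonym ypoly = "dpoly poly"

definition yC :: "real \<Rightarrow> ypoly" where "yC r = [:[:[:r:]:]:]"
definition yY :: ypoly where "yY = [:0, 1:]"
definition yDa :: ypoly where "yDa = [:[:0, 1:]:]"
definition yDb :: ypoly where "yDb = [:[:[:0, 1:]:]:]"

text \<open>\<open>at_x F p\<close> is the series \<open>F(x p)\<close> in \<open>x\<close>.\<close>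

definition at_x :: "real fps \<Rightarrow> ypoly \<Rightarrow> ypoly fps" where
  "at_x F p = Abs_fps (\<lambda>k. yC (fps_nth F k) * p ^ k)"

text \<open>
  The formal transform \<open>y\<^sup>n \<mapsto> n! / s\<^sup>n\<^sup>+\<^sup>1\<close>, linear over polynomials in \<open>\<partial>\<^sub>a\<close>, \<open>\<partial>\<^sub>b\<close>;
  unlike the integral it makes sense for negative \<open>s\<close> as well.
\<close>

definition laplace_poly :: "real \<Rightarrow> ypoly \<Rightarrow> dpoly" where
  "laplace_poly s h = (\<Sum>n\<le>degree h. [:[:fact n / s ^ (n + 1):]:] * coeff h n)"

definition laplace :: "real \<Rightarrow> ypoly fps \<Rightarrow> dpoly fps" where
  "laplace s F = Abs_fps (\<lambda>n. laplace_poly s (fps_nth F n))"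

text \<open>In the last term, \<open>fps_shift 1\<close> divides by \<open>x\<close> a series without constant term.\<close>

definition symbol1 :: "ypoly fps" where
  "symbol1 =
     fps_const (yC (1/2) * yY)
   - fps_const (yC (1/2) * (yDa - yDb)) * at_x fps_tanh (yC (1/2) * yY)
   - fps_const (yC (1/4)) * fps_X * fps_const (yY * (yDa - yDb)) * (at_x fps_sech (yC (1/2) * yY))\<^sup>2
   + fps_const (yC (1/2) * yY) * at_x fps_sech (yC (1/2) * yY)
       * at_x fps_sinh (yC (1/2) * (yDa - yDb))
       * at_x fps_sech (yC (1/2) * (yDa - yDb + yY))
   - fps_shift 1 (at_x fps_sinh (yC (1/2) * yY))
       * at_x (fps_exp 1) (yC (1/2) * (yDa + yDb))
       * at_x fps_sech (yC (1/2) * (yDa - yDb + yY))"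

definition symbol2 :: "ypoly fps" where
  "symbol2 = at_x fps_tanh (yC (1/2) * (yY - yDb))"

definition symbol3 :: "ypoly fps" where
  "symbol3 =
     - fps_const (yC (1/4)) * fps_X
       * (- 2 + fps_X * fps_const yY * at_x fps_tanh (yC (1/2) * yY))
       * (at_x fps_sech (yC (1/2) * yY))\<^sup>2"

definition poly_act :: "dpoly \<Rightarrow> (real \<Rightarrow> real \<Rightarrow> real) \<Rightarrow> real \<Rightarrow> real \<Rightarrow> real" where
  "poly_act P g a b =
     (\<Sum>i\<le>degree P. \<Sum>j\<le>degree (coeff P i).
        coeff (coeff P i) j * (pda ^^ i) ((pdb ^^ j) g) a b)"

definition act :: "dpoly fps \<Rightarrow> (real \<Rightarrow> real \<Rightarrow> real fps) \<Rightarrow> real \<Rightarrow> real \<Rightarrow> real fps" where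
  "act E g a b =
     Abs_fps (\<lambda>n. \<Sum>k\<le>n. poly_act (fps_nth E k) (\<lambda>u v. fps_nth (g u v) (n - k)) a b)"

definition D1 :: "real \<Rightarrow> (real \<Rightarrow> real \<Rightarrow> real fps) \<Rightarrow> real fps" where
  "D1 s g = act (fps_const [:[:s:]:] * laplace s symbol1) g (- s) s"

text \<open>
  The remaining operators do not involve \<open>\<partial>\<^sub>a\<close> and are applied to functions of \<open>b\<close> alone,
  which are extended to be constant in \<open>a\<close>; the point \<open>a = 0\<close> is therefore immaterial.
\<close>

definition act_b :: "dpoly fps \<Rightarrow> (real \<Rightarrow> real fps) \<Rightarrow> real \<Rightarrow> real fps" where
  "act_b E g b = act E (\<lambda>_. g) 0 b"

definition D2 :: "real \<Rightarrow> (real \<Rightarrow> real fps) \<Rightarrow> real fps" where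
  "D2 s g = act_b (fps_const [:[:s:]:] * laplace s symbol2) g s"

definition D3 :: "real \<Rightarrow> (real \<Rightarrow> real fps) \<Rightarrow> real fps" where
  "D3 s g = act_b (fps_const [:[:s:]:] * laplace s symbol3) g s"

text \<open>This is \<open>2 s / (1 + exp (x \<partial>\<^sub>b))\<close> at \<open>b = s\<close>, through the expansion with coefficients \<open>E\<^sub>i(0) / i!\<close>.\<close>

definition euler_op :: "real \<Rightarrow> (real \<Rightarrow> real fps) \<Rightarrow> real fps" where
  "euler_op s g =
     act_b (fps_const [:[:s:]:]
              * Abs_fps (\<lambda>i. [:[:euler_poly i 0 / fact i:]:] * [:[:0, 1:]:] ^ i)) g s"

end

theory Submission
  imports Defs
begin

text \<open>
  Each coefficient in \<open>x\<close> of either side is a finite combination of partial derivatives of \<open>f\<close> at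
  the two points \<open>(0, s)\<close> and \<open>(0, -s)\<close>.  The proof writes every term in the form
  \<open>s \<L>\<^sub>y{F(y, \<partial>\<^sub>a, \<partial>\<^sub>b)} \<circ> f\<close> at \<open>(0, s)\<close> or \<open>(0, -s)\<close> (this is \<open>lap_at\<close>), after which
  the theorem is an identity between the integrands \<open>F\<close>, that is, an identity between hyperbolic
  functions in the commutative ring of power series in \<open>x\<close> over the polynomials in \<open>y\<close>, \<open>\<partial>\<^sub>a\<close>, \<open>\<partial>\<^sub>b\<close>.

  Two classical rules bring the terms into this form.  Integration by parts,
  \<open>s \<L>{h} = h(0) + \<L>{h'}\<close> (\<open>laplace_poly_pderiv\<close>), removes multiplications by \<open>s\<close>.  And
  \<open>1/b = \<integral> exp (-b y) dy\<close> suggests \<open>\<phi>(\<partial>\<^sub>b) \<circ> (g/b) = \<L>\<^sub>y{\<phi>(\<partial>\<^sub>b - y)} \<circ> g\<close> at \<open>b\<close>, which turns the Euler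
  operator on the left, applied to functions divided by \<open>b\<close>, into a Laplace transform
  (\<open>pdb_power_divide\<close>, \<open>euler_op_eq_lap_at\<close>).

  In the term with \<open>\<D>\<^sub>1\<close> the functions \<open>b f(a+b,a)\<close> and \<open>a f(a+b,b)\<close> are differentiated by the
  Leibniz rule \<open>P(\<partial>\<^sub>a,\<partial>\<^sub>b) \<circ> (b g) = b (P \<circ> g) + (dP/d\<partial>\<^sub>b) \<circ> g\<close>.  At \<open>a = -s\<close>, \<open>b = s\<close> the factors \<open>a\<close>
  and \<open>b\<close> become \<open>-s\<close> and \<open>s\<close>, and since the symbol \<open>S\<close> of \<open>\<D>\<^sub>1\<close> vanishes at \<open>y = 0\<close>, integration by
  parts leaves the integrands \<open>(d/dy + d/d\<partial>\<^sub>b) S\<close> on \<open>f(a+b,a)\<close> and \<open>(d/d\<partial>\<^sub>a - d/dy) S\<close> on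
  \<open>f(a+b,b)\<close> (\<open>D1_eq_lap_at\<close>).  Both derivations annihilate \<open>\<partial>\<^sub>a - \<partial>\<^sub>b + y\<close>, so they do not act on the
  factors \<open>sech (x(\<partial>\<^sub>a - \<partial>\<^sub>b + y)/2)\<close>, and most of what they produce cancels by the addition theorems.
  What remains (\<open>symbol1_da_minus_dy\<close>, \<open>symbol1_dy_plus_db\<close>) contains the symbol of \<open>\<D>\<^sub>3\<close> and, for
  \<open>f(a+b,b)\<close>, that of \<open>\<D>\<^sub>2\<close>, both with a negative sign; the rest is the left-hand side.

  The chain rule translates derivatives of \<open>f(a+b,a)\<close> and \<open>f(a+b,b)\<close> into derivatives of \<open>f\<close>.  It is
  phrased as a relation between operators (\<open>subst_rel\<close>) that is compatible with ring operations,
  hence passes to power series in \<open>x\<close>.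
\<close>

section \<open>Smooth functions of two variables\<close>

lemma smooth2_pda: "smooth2 g \<Longrightarrow> smooth2 (pda g)"
  and smooth2_pdb: "smooth2 g \<Longrightarrow> smooth2 (pdb g)"
  unfolding smooth2_def by (metis C_diff.simps(2))+

text \<open>
  Smoothness is the largest property that implies continuity and partial differentiability and
  passes to both partial derivatives.
\<close>

lemma smooth2_coinduct:
  assumes "S g"
    and cont: "\<And>h. S h \<Longrightarrow> continuous_on UNIV (\<lambda>p. h (fst p) (snd p))"
    and da: "\<And>h a b. S h \<Longrightarrow> (\<lambda>t. h t b) differentiable (at a)"
    and db: "\<And>h a b. S h \<Longrightarrow> (\<lambda>t. h a t) differentiable (at b)"
    and closed: "\<And>h. S h \<Longrightarrow> S (pda h)" "\<And>h. S h \<Longrightarrow> S (pdb h)"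
  shows "smooth2 g"
proof -
  have "C_diff k h" if "S h" for k h
    using that by (induction k arbitrary: h) (auto intro: cont da db closed)
  then show ?thesis
    using \<open>S g\<close> by (simp add: smooth2_def)
qed

lemma DERIV_pda: "smooth2 g \<Longrightarrow> ((\<lambda>t. g t b) has_real_derivative pda g a b) (at a)"
  and DERIV_pdb: "smooth2 g \<Longrightarrow> ((\<lambda>t. g a t) has_real_derivative pdb g a b) (at b)"
  unfolding smooth2_def pda_def pdb_def
  by (metis C_diff.simps(2) DERIV_deriv_iff_real_differentiable)+

lemma smooth2_continuous: "smooth2 g \<Longrightarrow> continuous_on UNIV (\<lambda>p. g (fst p) (snd p))"
  unfolding smooth2_def by (metis C_diff.simps(1))

lemma pda_eqI: "(\<And>a b. ((\<lambda>t. g t b) has_real_derivative d a b) (at a)) \<Longrightarrow> pda g = d"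
  and pdb_eqI: "(\<And>a b. ((\<lambda>t. g a t) has_real_derivative d a b) (at b)) \<Longrightarrow> pdb g = d"
  unfolding pda_def pdb_def by (intro ext DERIV_imp_deriv; simp)+

text \<open>
  The mean value theorem in each variable expresses the mixed second difference over a square by a
  mixed second derivative.  Exchanging the variables gives the other mixed derivative for the same
  difference, which proves the symmetry of second derivatives as the square shrinks.
\<close>

lemma rectangle_mean_value:
  fixes g g1 g12 :: "real \<Rightarrow> real \<Rightarrow> real"
  assumes d1: "\<And>u v. ((\<lambda>t. g t v) has_real_derivative g1 u v) (at u)"
    and d12: "\<And>u v. ((\<lambda>t. g1 u t) has_real_derivative g12 u v) (at v)"
    and "h > 0"
  shows "\<exists>u v. a < u \<and> u < a + h \<and> b < v \<and> v < b + h \<and>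
    g (a + h) (b + h) - g (a + h) b - g a (b + h) + g a b = h\<^sup>2 * g12 u v"
proof -
  have "((\<lambda>t. g t (b + h) - g t b) has_real_derivative (g1 u (b + h) - g1 u b)) (at u)" for u
    by (intro DERIV_diff d1)
  then obtain u where u: "a < u" "u < a + h"
    "(g (a + h) (b + h) - g (a + h) b) - (g a (b + h) - g a b) = (a + h - a) * (g1 u (b + h) - g1 u b)"
    using MVT2[of a "a + h" "\<lambda>t. g t (b + h) - g t b" "\<lambda>u. g1 u (b + h) - g1 u b"] \<open>h > 0\<close> by auto
  moreover obtain v where v: "b < v" "v < b + h"
    "g1 u (b + h) - g1 u b = (b + h - b) * g12 u v"
    using MVT2[of b "b + h" "g1 u" "g12 u"] \<open>h > 0\<close> d12 by auto
  ultimately show ?thesis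
    by (intro exI[of _ u] exI[of _ v]) (auto simp: power2_eq_square)
qed

lemma pda_pdb_commute:
  assumes "smooth2 g"
  shows "pda (pdb g) = pdb (pda g)"
proof (intro ext, rule ccontr)
  fix a b
  define P where "P = pdb (pda g)"
  define Q where "Q = pda (pdb g)"
  assume "pda (pdb g) a b \<noteq> pdb (pda g) a b"
  then have e: "\<bar>P a b - Q a b\<bar> / 2 > 0" (is "?e > 0")
    by (simp add: P_def Q_def)
  have near: "\<exists>r>0. \<forall>u v. \<bar>u - a\<bar> < r \<and> \<bar>v - b\<bar> < r \<longrightarrow> \<bar>R u v - R a b\<bar> < ?e" if "smooth2 R" for R
  proof -
    have "continuous (at (a, b)) (\<lambda>p. R (fst p) (snd p))"
      using smooth2_continuous[OF that] by (simp add: continuous_on_eq_continuous_at)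
    then have "\<exists>r>0. \<forall>p. dist p (a, b) < r \<longrightarrow>
        dist (R (fst p) (snd p)) (R (fst (a, b)) (snd (a, b))) < ?e"
      unfolding continuous_at_eps_delta using e by blast
    then obtain r where "r > 0" and
      r: "\<And>p. dist p (a, b) < r \<Longrightarrow> dist (R (fst p) (snd p)) (R a b) < ?e"
      by auto
    have "\<bar>R u v - R a b\<bar> < ?e" if "\<bar>u - a\<bar> < r / 2" "\<bar>v - b\<bar> < r / 2" for u v
    proof -
      have "dist (u, v) (a, b) \<le> dist u a + dist v b"
        unfolding dist_Pair_Pair by (rule sqrt_sum_squares_le_sum) auto
      also have "\<dots> < r"
        using that by (simp add: dist_real_def)
      finally show ?thesis
        using r[of "(u, v)"] by (simp add: dist_real_def)
    qed
    then show ?thesis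
      using \<open>r > 0\<close> by (intro exI[of _ "r / 2"]) auto
  qed
  have "smooth2 P" "smooth2 Q"
    unfolding P_def Q_def by (intro smooth2_pda smooth2_pdb assms)+
  from near[OF this(1)] near[OF this(2)] obtain r1 r2 where r: "r1 > 0" "r2 > 0"
    and r1: "\<And>u v. \<bar>u - a\<bar> < r1 \<Longrightarrow> \<bar>v - b\<bar> < r1 \<Longrightarrow> \<bar>P u v - P a b\<bar> < ?e"
    and r2: "\<And>u v. \<bar>u - a\<bar> < r2 \<Longrightarrow> \<bar>v - b\<bar> < r2 \<Longrightarrow> \<bar>Q u v - Q a b\<bar> < ?e"
    by blast
  define h where "h = min r1 r2"
  have "h > 0"
    using r by (simp add: h_def)
  obtain u v where uv: "a < u" "u < a + h" "b < v" "v < b + h" and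
    P: "g (a + h) (b + h) - g (a + h) b - g a (b + h) + g a b = h\<^sup>2 * P u v"
    using rectangle_mean_value[of g "pda g" P h a b] \<open>h > 0\<close>
      DERIV_pda[OF assms] DERIV_pdb[OF smooth2_pda[OF assms]] P_def by blast
  \<comment> \<open>the same increment, differentiated in the other order\<close>
  obtain v' u' where uv': "b < v'" "v' < b + h" "a < u'" "u' < a + h" and
    Q: "g (a + h) (b + h) - g a (b + h) - g (a + h) b + g a b = h\<^sup>2 * Q u' v'"
    using rectangle_mean_value[of "\<lambda>v u. g u v" "\<lambda>v u. pdb g u v" "\<lambda>v u. Q u v" h b a] \<open>h > 0\<close>
      DERIV_pdb[OF assms] DERIV_pda[OF smooth2_pdb[OF assms]] Q_def by blast
  have "h\<^sup>2 * P u v = h\<^sup>2 * Q u' v'"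
    using P Q by linarith
  then have "P u v = Q u' v'"
    using \<open>h > 0\<close> by simp
  moreover have "\<bar>P u v - P a b\<bar> < ?e" "\<bar>Q u' v' - Q a b\<bar> < ?e"
    using uv uv' by (intro r1 r2; simp add: h_def)+
  ultimately show False
    using abs_triangle_ineq4[of "P u v - Q a b" "P u v - P a b"] by simp
qed

text \<open>
  Continuity of the partial derivatives gives total differentiability, on which the chain rule rests.
\<close>

lemma smooth2_has_derivative:
  assumes "smooth2 g"
  shows "((\<lambda>(x, y). g x y) has_derivative (\<lambda>(tx, ty). pda g x y * tx + pdb g x y * ty)) (at (x, y))"
proof -
  have "continuous (at (x, y)) (\<lambda>p. pdb g (fst p) (snd p))"
    using smooth2_continuous[OF smooth2_pdb[OF assms]] by (simp add: continuous_on_eq_continuous_at)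
  then have "continuous (at (x, y)) (\<lambda>p. blinfun_mult_right (pdb g (fst p) (snd p)))"
    by (rule bounded_linear.continuous[OF bounded_linear_blinfun_mult_right])
  then have "continuous (at (x, y) within UNIV \<times> UNIV) (\<lambda>(x, y). blinfun_mult_right (pdb g x y))"
    by (simp add: case_prod_unfold)
  then have "((\<lambda>(x, y). g x y) has_derivative
      (\<lambda>(tx, ty). pda g x y * tx + blinfun_mult_right (pdb g x y) ty)) (at (x, y) within UNIV \<times> UNIV)"
    using DERIV_pda[OF assms] DERIV_pdb[OF assms]
    by (intro has_derivative_partialsI) (auto simp: has_field_derivative_def)
  then show ?thesis
    by simp
qed

lemma DERIV_smooth2_affine:
  assumes "smooth2 g"
  shows "((\<lambda>t. g (p * t + q) (r * t + w)) has_real_derivative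
     p * pda g (p * t + q) (r * t + w) + r * pdb g (p * t + q) (r * t + w)) (at t)"
proof -
  have "((\<lambda>t. (p * t + q, r * t + w)) has_derivative (\<lambda>h. (p * h, r * h))) (at t)"
    by (auto intro!: derivative_eq_intros)
  then have "((\<lambda>t. (\<lambda>(x, y). g x y) (p * t + q, r * t + w)) has_derivative
     (\<lambda>h. (\<lambda>(tx, ty). pda g (p * t + q) (r * t + w) * tx + pdb g (p * t + q) (r * t + w) * ty) (p * h, r * h))) (at t)"
    using has_derivative_compose smooth2_has_derivative[OF assms] by blast
  moreover have "(\<lambda>h. (\<lambda>(tx, ty). pda g (p * t + q) (r * t + w) * tx + pdb g (p * t + q) (r * t + w) * ty) (p * h, r * h))
      = (*) (p * pda g (p * t + q) (r * t + w) + r * pdb g (p * t + q) (r * t + w))"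
    by (simp add: fun_eq_iff algebra_simps)
  ultimately show ?thesis
    by (simp only: has_field_derivative_def case_prod_conv)
qed

definition lin_subst :: "real \<Rightarrow> real \<Rightarrow> real \<Rightarrow> real \<Rightarrow> (real \<Rightarrow> real \<Rightarrow> real) \<Rightarrow> real \<Rightarrow> real \<Rightarrow> real" where
  "lin_subst p q r w g = (\<lambda>a b. g (p * a + q * b) (r * a + w * b))"

lemma pd_add:
  assumes "smooth2 f" "smooth2 g"
  shows "pda (\<lambda>a b. f a b + g a b) = (\<lambda>a b. pda f a b + pda g a b)"
    and "pdb (\<lambda>a b. f a b + g a b) = (\<lambda>a b. pdb f a b + pdb g a b)"
  by (intro pda_eqI pdb_eqI DERIV_add DERIV_pda DERIV_pdb assms)+

lemma DERIV_lin_subst: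
  assumes "smooth2 g"
  shows "((\<lambda>t. lin_subst p q r w g t b) has_real_derivative
            p * lin_subst p q r w (pda g) a b + r * lin_subst p q r w (pdb g) a b) (at a)"
    and "((\<lambda>t. lin_subst p q r w g a t) has_real_derivative
            q * lin_subst p q r w (pda g) a b + w * lin_subst p q r w (pdb g) a b) (at b)"
  using DERIV_smooth2_affine[OF assms, of p "q * b" r "w * b" a]
    DERIV_smooth2_affine[OF assms, of q "p * a" w "r * a" b]
  by (simp_all add: lin_subst_def add.commute)

lemma pd_lin_subst:
  assumes "smooth2 g"
  shows "pda (lin_subst p q r w g) =
      (\<lambda>a b. p * lin_subst p q r w (pda g) a b + r * lin_subst p q r w (pdb g) a b)"
    and "pdb (lin_subst p q r w g) =
      (\<lambda>a b. q * lin_subst p q r w (pda g) a b + w * lin_subst p q r w (pdb g) a b)"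
  by (intro pda_eqI pdb_eqI DERIV_lin_subst assms)+

text \<open>
  Smoothness of sums, products, coordinates and linear substitutions follows by coinduction from
  one class of functions that is closed under all these constructions at once.
\<close>

inductive smooth_closure :: "(real \<Rightarrow> real \<Rightarrow> real) \<Rightarrow> bool" where
  base: "smooth2 g \<Longrightarrow> smooth_closure (lin_subst p q r w g)"
| const: "smooth_closure (\<lambda>a b. c)"
| fst: "smooth_closure (\<lambda>a b. a)"
| snd: "smooth_closure (\<lambda>a b. b)"
| add: "smooth_closure f \<Longrightarrow> smooth_closure g \<Longrightarrow> smooth_closure (\<lambda>a b. f a b + g a b)"
| mult: "smooth_closure f \<Longrightarrow> smooth_closure g \<Longrightarrow> smooth_closure (\<lambda>a b. f a b * g a b)"

lemma smooth_closure_derivatives: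
  assumes "smooth_closure h"
  shows "\<exists>da db. smooth_closure da \<and> smooth_closure db \<and>
    (\<forall>a b. ((\<lambda>t. h t b) has_real_derivative da a b) (at a)) \<and>
    (\<forall>a b. ((\<lambda>t. h a t) has_real_derivative db a b) (at b))"
  using assms
proof induction
  case (base g p q r w)
  then show ?case
    by (intro exI[of _ "\<lambda>a b. p * lin_subst p q r w (pda g) a b + r * lin_subst p q r w (pdb g) a b"]
        exI[of _ "\<lambda>a b. q * lin_subst p q r w (pda g) a b + w * lin_subst p q r w (pdb g) a b"]
        conjI allI DERIV_lin_subst smooth_closure.intros smooth2_pda smooth2_pdb)
next
  case (const c)
  show ?case
    by (intro exI[of _ "\<lambda>a b. 0"]) (auto intro!: smooth_closure.intros)
next
  case fst
  show ?case
    by (rule exI[of _ "\<lambda>a b. 1"], rule exI[of _ "\<lambda>a b. 0"]) (auto intro!: smooth_closure.intros)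
next
  case snd
  show ?case
    by (rule exI[of _ "\<lambda>a b. 0"], rule exI[of _ "\<lambda>a b. 1"]) (auto intro!: smooth_closure.intros)
next
  case (add f g)
  then obtain fa fb ga gb where
    "smooth_closure fa" "smooth_closure fb" "smooth_closure ga" "smooth_closure gb"
    and "\<And>a b. ((\<lambda>t. f t b) has_real_derivative fa a b) (at a)"
      "\<And>a b. ((\<lambda>t. f a t) has_real_derivative fb a b) (at b)"
      "\<And>a b. ((\<lambda>t. g t b) has_real_derivative ga a b) (at a)"
      "\<And>a b. ((\<lambda>t. g a t) has_real_derivative gb a b) (at b)"
    by metis
  then show ?case
    by (intro exI[of _ "\<lambda>a b. fa a b + ga a b"] exI[of _ "\<lambda>a b. fb a b + gb a b"])
      (auto intro!: smooth_closure.intros derivative_intros)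
next
  case (mult f g)
  then obtain fa fb ga gb where
    "smooth_closure fa" "smooth_closure fb" "smooth_closure ga" "smooth_closure gb"
    and "\<And>a b. ((\<lambda>t. f t b) has_real_derivative fa a b) (at a)"
      "\<And>a b. ((\<lambda>t. f a t) has_real_derivative fb a b) (at b)"
      "\<And>a b. ((\<lambda>t. g t b) has_real_derivative ga a b) (at a)"
      "\<And>a b. ((\<lambda>t. g a t) has_real_derivative gb a b) (at b)"
    by metis
  with mult.hyps show ?case
    by (intro exI[of _ "\<lambda>a b. fa a b * g a b + f a b * ga a b"]
        exI[of _ "\<lambda>a b. fb a b * g a b + f a b * gb a b"])
      (auto intro!: smooth_closure.intros derivative_eq_intros)
qed

lemma smooth_closure_continuous:
  "smooth_closure h \<Longrightarrow> continuous_on UNIV (\<lambda>p. h (fst p) (snd p))"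
proof (induction rule: smooth_closure.induct)
  case (base g p q r w)
  have "continuous_on UNIV ((\<lambda>x. g (fst x) (snd x)) \<circ> (\<lambda>x. (p * fst x + q * snd x, r * fst x + w * snd x)))"
    by (rule continuous_on_compose)
      (auto intro!: continuous_intros continuous_on_subset[OF smooth2_continuous[OF base]])
  then show ?case
    by (simp add: lin_subst_def o_def)
qed (auto intro!: continuous_intros)

lemma smooth2_smooth_closure:
  assumes "smooth_closure g"
  shows "smooth2 g"
proof (rule smooth2_coinduct[where S = smooth_closure])
  fix h a b
  assume "smooth_closure h"
  then obtain da db where d: "smooth_closure da" "smooth_closure db"
    and da: "\<And>a b. ((\<lambda>t. h t b) has_real_derivative da a b) (at a)"
    and db: "\<And>a b. ((\<lambda>t. h a t) has_real_derivative db a b) (at b)"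
    using smooth_closure_derivatives by metis
  show "(\<lambda>t. h t b) differentiable (at a)" "(\<lambda>t. h a t) differentiable (at b)"
    using da db by (meson real_differentiable_def)+
  have "pda h = da" "pdb h = db"
    by (intro pda_eqI pdb_eqI da db)+
  with d show "smooth_closure (pda h)" "smooth_closure (pdb h)"
    by simp_all
qed (auto intro: assms smooth_closure_continuous)

lemma smooth_closure_smooth2: "smooth2 g \<Longrightarrow> smooth_closure g"
  using smooth_closure.base[of g 1 0 0 1] by (simp add: lin_subst_def)

lemma smooth2_intros:
  "smooth2 (\<lambda>a b. c)"
  "smooth2 (\<lambda>a b. a)"
  "smooth2 (\<lambda>a b. b)"
  "smooth2 f \<Longrightarrow> smooth2 g \<Longrightarrow> smooth2 (\<lambda>a b. f a b + g a b)"
  "smooth2 f \<Longrightarrow> smooth2 g \<Longrightarrow> smooth2 (\<lambda>a b. f a b * g a b)"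
  "smooth2 g \<Longrightarrow> smooth2 (lin_subst p q r w g)"
  by (rule smooth2_smooth_closure; simp add: smooth_closure.intros smooth_closure_smooth2)+

section \<open>Derivations\<close>

definition derivation :: "('a::comm_ring_1 \<Rightarrow> 'a) \<Rightarrow> bool" where
  "derivation d \<longleftrightarrow> (\<forall>x y. d (x + y) = d x + d y) \<and> (\<forall>x y. d (x * y) = d x * y + x * d y)"

lemma derivation_add: "derivation d \<Longrightarrow> d (x + y) = d x + d y"
  and derivation_mult: "derivation d \<Longrightarrow> d (x * y) = d x * y + x * d y"
  by (simp_all add: derivation_def)

lemma derivation_0 [simp]: "derivation d \<Longrightarrow> d 0 = 0"
  using derivation_add[of d 0 0] by simp

lemma derivation_minus: "derivation d \<Longrightarrow> d (- x) = - d x"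
  using derivation_add[of d x "- x"] by (simp add: eq_neg_iff_add_eq_0 add.commute)

lemma derivation_diff: "derivation d \<Longrightarrow> d (x - y) = d x - d y"
  using derivation_add[of d x "- y"] by (simp add: derivation_minus)

lemma derivation_sum: "derivation d \<Longrightarrow> d (\<Sum>i\<in>A. g i) = (\<Sum>i\<in>A. d (g i))"
  by (induction A rule: infinite_finite_induct) (simp_all add: derivation_add)

lemma derivation_1 [simp]: "derivation d \<Longrightarrow> d 1 = 0"
  using derivation_mult[of d 1 1] by simp

lemma derivation_power: "derivation d \<Longrightarrow> d (x ^ n) = of_nat n * x ^ (n - 1) * d x"
proof (induction n)
  case (Suc n)
  then show ?case
    by (cases n) (simp_all add: derivation_mult algebra_simps)
qed simp

lemma derivation_combine:
  assumes "derivation d" "derivation d'"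
  shows "derivation (\<lambda>x. d x + d' x)" "derivation (\<lambda>x. d x - d' x)"
  using assms by (auto simp: derivation_def algebra_simps)

lemma derivation_pderiv: "derivation (pderiv :: 'a::idom poly \<Rightarrow> _)"
  by (simp add: derivation_def pderiv_add pderiv_mult algebra_simps)

lemma derivation_map_poly:
  assumes "derivation d"
  shows "derivation (map_poly d)"
  using assms
  by (auto simp: derivation_def poly_eq_iff coeff_map_poly coeff_mult derivation_sum[OF assms]
      sum.distrib derivation_mult[OF assms])

definition fps_map :: "('a \<Rightarrow> 'b) \<Rightarrow> 'a fps \<Rightarrow> 'b fps" where
  "fps_map d F = Abs_fps (\<lambda>n. d (fps_nth F n))"

lemma fps_map_nth [simp]: "fps_nth (fps_map d F) n = d (fps_nth F n)"
  by (simp add: fps_map_def)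

lemma derivation_fps_map:
  assumes "derivation d"
  shows "derivation (fps_map d)"
  by (auto simp: derivation_def fps_eq_iff fps_mult_nth derivation_sum[OF assms]
      sum.distrib derivation_mult[OF assms] derivation_add[OF assms])

lemma fps_map_const: "d 0 = 0 \<Longrightarrow> fps_map d (fps_const c) = fps_const (d c)"
  by (auto simp: fps_eq_iff)

lemma fps_map_fps_X: "derivation d \<Longrightarrow> fps_map d fps_X = 0"
  by (auto simp: fps_eq_iff fps_X_def)

lemma fps_map_fps_shift: "fps_map d (fps_shift k F) = fps_shift k (fps_map d F)"
  by (auto simp: fps_eq_iff)

section \<open>Hyperbolic functions as power series\<close>

lemma yC_add: "yC (r + t) = yC r + yC t"
  and yC_mult: "yC (r * t) = yC r * yC t"
  and yC_0: "yC 0 = 0"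
  and yC_1: "yC 1 = 1"
  and yC_minus: "yC (- r) = - yC r"
  by (simp_all add: yC_def one_pCons)

lemma yC_sum: "yC (\<Sum>i\<in>A. g i) = (\<Sum>i\<in>A. yC (g i))"
  by (induction A rule: infinite_finite_induct) (simp_all add: yC_add yC_0)

lemma yC_power: "yC (r ^ n) = yC r ^ n"
  by (induction n) (simp_all add: yC_mult yC_1)

lemma yC_of_nat: "yC (of_nat n) = of_nat n"
  by (induction n) (simp_all add: yC_add yC_0 yC_1)

lemma at_x_nth [simp]: "fps_nth (at_x F p) n = yC (fps_nth F n) * p ^ n"
  by (simp add: at_x_def)

lemma at_x_add: "at_x (F + G) p = at_x F p + at_x G p"
  by (simp add: fps_eq_iff yC_add algebra_simps)

lemma at_x_minus: "at_x (- F) p = - at_x F p"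
  by (simp add: fps_eq_iff yC_minus)

lemma at_x_diff: "at_x (F - G) p = at_x F p - at_x G p"
  using at_x_add[of F "- G"] by (simp add: at_x_minus)

lemma at_x_const: "at_x (fps_const c) p = fps_const (yC c)"
  by (auto simp: fps_eq_iff yC_0)

lemma at_x_1: "at_x 1 p = 1"
  using at_x_const[of 1] by (simp add: yC_1)

text \<open>
  For fixed \<open>p\<close>, substitution of \<open>x p\<close> is a ring homomorphism; identities between real power series
  in one variable thereby become identities over the symbols.
\<close>

lemma at_x_mult: "at_x (F * G) p = at_x F p * at_x G p"
proof -
  have "yC (fps_nth F i * fps_nth G (n - i)) * p ^ n =
      (yC (fps_nth F i) * p ^ i) * (yC (fps_nth G (n - i)) * p ^ (n - i))" if "i \<le> n" for i n
  proof -
    have "p ^ n = p ^ i * p ^ (n - i)"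
      using that by (simp flip: power_add)
    then show ?thesis
      by (simp add: yC_mult algebra_simps)
  qed
  then show ?thesis
    by (auto simp: fps_eq_iff fps_mult_nth yC_sum sum_distrib_right intro!: sum.cong)
qed

lemma at_x_exp_add: "at_x (fps_exp 1) (p + q) = at_x (fps_exp 1) p * at_x (fps_exp 1) q"
proof (rule fps_ext)
  fix n
  have "yC (1 / fact n) * (of_nat (n choose i) * p ^ i * q ^ (n - i)) =
      (yC (1 / fact i) * p ^ i) * (yC (1 / fact (n - i)) * q ^ (n - i))" if "i \<le> n" for i
  proof -
    have "(1 / fact n) * real (n choose i) = (1 / fact i) * (1 / fact (n - i))"
      using that by (simp add: binomial_fact)
    then have "yC (1 / fact n) * of_nat (n choose i) = yC (1 / fact i) * yC (1 / fact (n - i))"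
      by (metis yC_mult yC_of_nat)
    then show ?thesis
      by (simp add: algebra_simps)
  qed
  then show "fps_nth (at_x (fps_exp 1) (p + q)) n = fps_nth (at_x (fps_exp 1) p * at_x (fps_exp 1) q) n"
    by (auto simp: fps_mult_nth binomial_ring sum_distrib_left atMost_atLeast0 intro!: sum.cong)
qed

lemma at_x_exp_0: "at_x (fps_exp 1) 0 = 1"
  by (auto simp: fps_eq_iff power_0_left yC_1)

lemma at_x_exp_minus: "at_x (fps_exp (- 1)) p = at_x (fps_exp 1) (- p)"
proof -
  have "(- p) ^ n = yC ((- 1) ^ n) * p ^ n" for n
    by (metis mult_minus1 power_mult_distrib yC_1 yC_minus yC_power)
  then show ?thesis
    by (simp add: fps_eq_iff mult.assoc[symmetric] flip: yC_mult)
qed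

text \<open>The chain rule for \<open>F(x p)\<close>, with \<open>x\<close> as a constant.\<close>

lemma fps_map_at_x:
  assumes "derivation d" and const: "\<And>r. d (yC r) = 0"
  shows "fps_map d (at_x F p) = fps_X * fps_const (d p) * at_x (fps_deriv F) p"
proof (rule fps_ext)
  fix n
  show "fps_nth (fps_map d (at_x F p)) n = fps_nth (fps_X * fps_const (d p) * at_x (fps_deriv F) p) n"
    by (cases n) (simp_all add: mult.assoc derivation_mult[OF assms(1)] derivation_power[OF assms(1)] const
        assms(1) yC_mult yC_add yC_of_nat yC_1 yC_0 algebra_simps del: power_Suc)
qed

lemma fps_sech_cosh: "fps_sech * fps_cosh = 1"
  unfolding fps_sech_def
  by (simp add: fps_cosh_def fps_divide_unit inverse_mult_eq_1)

lemma fps_tanh_eq: "fps_tanh = fps_sinh * fps_sech"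
  unfolding fps_tanh_def fps_sech_def by (simp add: fps_cosh_def fps_divide_unit)

lemma fps_deriv_sinh: "fps_deriv fps_sinh = fps_cosh"
  and fps_deriv_cosh: "fps_deriv fps_cosh = fps_sinh"
  by (simp_all add: fps_sinh_def fps_cosh_def fps_eq_iff)

lemma fps_cosh_sinh: "fps_cosh\<^sup>2 - fps_sinh\<^sup>2 = 1"
proof -
  have "fps_exp 1 * fps_exp (- 1) = (1 :: real fps)"
    by (simp flip: fps_exp_add_mult)
  moreover have "fps_const (1/2 :: real) * 2 = 1"
    by (simp add: fps_eq_iff numeral_fps_const)
  ultimately show ?thesis
    unfolding fps_cosh_def fps_sinh_def by algebra
qed

lemma fps_deriv_sech: "fps_deriv fps_sech = - fps_sech * fps_tanh"
proof -
  have "fps_sech * fps_deriv fps_cosh + fps_deriv fps_sech * fps_cosh = 0"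
    using arg_cong[OF fps_sech_cosh, of fps_deriv] by simp
  then show ?thesis
    using fps_sech_cosh unfolding fps_tanh_eq fps_deriv_cosh by algebra
qed

lemma fps_deriv_tanh: "fps_deriv fps_tanh = fps_sech\<^sup>2"
proof -
  have "fps_deriv fps_tanh = fps_sinh * fps_deriv fps_sech + fps_cosh * fps_sech"
    unfolding fps_tanh_eq by (simp add: fps_deriv_sinh)
  then show ?thesis
    using fps_sech_cosh fps_cosh_sinh unfolding fps_deriv_sech fps_tanh_eq by algebra
qed

text \<open>The generating function of the numbers \<open>E\<^sub>i(0) / i!\<close>.\<close>

definition fps_euler :: "real fps" where
  "fps_euler = 2 / (1 + fps_exp 1)"

lemma fps_euler_eq: "(1 + fps_exp 1) * fps_euler = 2"
proof -
  have "(1 + fps_exp 1) * inverse (1 + fps_exp (1 :: real)) = 1"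
    by (rule inverse_mult_eq_1') simp
  then show ?thesis
    unfolding fps_euler_def by (simp add: fps_divide_unit mult.left_commute[of _ 2])
qed

abbreviation fps_half :: "ypoly fps" where "fps_half \<equiv> fps_const (yC (1/2))"
abbreviation sinh_x :: "ypoly \<Rightarrow> ypoly fps" where "sinh_x \<equiv> at_x fps_sinh"
abbreviation cosh_x :: "ypoly \<Rightarrow> ypoly fps" where "cosh_x \<equiv> at_x fps_cosh"
abbreviation sech_x :: "ypoly \<Rightarrow> ypoly fps" where "sech_x \<equiv> at_x fps_sech"
abbreviation tanh_x :: "ypoly \<Rightarrow> ypoly fps" where "tanh_x \<equiv> at_x fps_tanh"
abbreviation exp_x :: "ypoly \<Rightarrow> ypoly fps" where "exp_x \<equiv> at_x (fps_exp 1)"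

lemma fps_half_double: "2 * fps_half = 1"
proof -
  have "2 * fps_half = fps_const (yC (1/2) + yC (1/2))"
    by (simp only: mult_2 fps_const_add)
  also have "\<dots> = 1"
    by (simp add: yC_1 flip: yC_add)
  finally show ?thesis .
qed

lemma cosh_x_eq: "cosh_x p = fps_half * (exp_x p + exp_x (- p))"
  and sinh_x_eq: "sinh_x p = fps_half * (exp_x p - exp_x (- p))"
  unfolding fps_cosh_def fps_sinh_def
  by (simp_all add: at_x_mult at_x_const at_x_add at_x_diff at_x_exp_minus)

lemma exp_x_minus: "exp_x p * exp_x (- p) = 1"
  using at_x_exp_add[of p "- p"] by (simp add: at_x_exp_0)

lemma sech_x_cosh_x: "sech_x p * cosh_x p = 1"
  by (simp add: fps_sech_cosh at_x_1 flip: at_x_mult)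

lemma tanh_x_eq: "tanh_x p = sinh_x p * sech_x p"
  by (simp add: fps_tanh_eq at_x_mult)

lemma cosh_x_sinh_x: "(cosh_x p)\<^sup>2 - (sinh_x p)\<^sup>2 = 1"
proof -
  have "(cosh_x p)\<^sup>2 - (sinh_x p)\<^sup>2 = at_x (fps_cosh\<^sup>2 - fps_sinh\<^sup>2) p"
    by (simp add: power2_eq_square at_x_diff at_x_mult)
  then show ?thesis
    by (simp add: fps_cosh_sinh at_x_1)
qed

lemma cosh_x_add: "cosh_x (p + q) = cosh_x p * cosh_x q + sinh_x p * sinh_x q"
  and sinh_x_add: "sinh_x (p + q) = sinh_x p * cosh_x q + cosh_x p * sinh_x q"
  using fps_half_double at_x_exp_add[of p q] at_x_exp_add[of "- p" "- q"]
  unfolding cosh_x_eq sinh_x_eq minus_add_distrib by algebra+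

text \<open>
  From \<open>2 / (1 + exp (-2w)) = exp w / cosh w\<close>.  This is how the Euler operator is compared with the
  hyperbolic functions in the other symbols.
\<close>

lemma euler_x_eq: "at_x fps_euler (- (p + p)) = exp_x p * sech_x p"
proof -
  have "(1 + exp_x (- (p + p))) * at_x fps_euler (- (p + p)) = at_x (fps_const 2) (- (p + p))"
    using fps_euler_eq by (simp add: numeral_fps_const flip: at_x_mult at_x_add at_x_1[of "- (p + p)"] del: minus_add_distrib)
  also have "\<dots> = 2"
    using yC_of_nat[of 2] by (simp add: at_x_const numeral_fps_const)
  finally have "(1 + exp_x (- p) * exp_x (- p)) * at_x fps_euler (- (p + p)) = 2"
    by (simp add: at_x_exp_add flip: at_x_exp_add)
  moreover have "exp_x (- p) = exp_x p * (exp_x (- p) * exp_x (- p))"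
    using exp_x_minus[of p] by (simp flip: mult.assoc)
  then have "(exp_x p + exp_x (- p)) * E = exp_x p * ((1 + exp_x (- p) * exp_x (- p)) * E)" for E
    by (simp add: algebra_simps)
  ultimately have "(exp_x p + exp_x (- p)) * at_x fps_euler (- (p + p)) = 2 * exp_x p"
    by (metis mult.commute)
  then have "cosh_x p * at_x fps_euler (- (p + p)) = fps_half * (2 * exp_x p)"
    unfolding cosh_x_eq by (simp only: mult.assoc)
  also have "\<dots> = (2 * fps_half) * exp_x p"
    by simp
  finally have "cosh_x p * at_x fps_euler (- (p + p)) = exp_x p"
    by (simp only: fps_half_double mult_1)
  then have "exp_x p * sech_x p = (sech_x p * cosh_x p) * at_x fps_euler (- (p + p))"
    by (simp add: mult.assoc)
  then show ?thesis
    by (simp add: sech_x_cosh_x)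
qed

section \<open>The derivatives of the first symbol\<close>

text \<open>
  The ring computation behind \<open>derivation_symbol1\<close>, over indeterminates.  Here \<open>h\<close> is one half, and with
  \<open>u = \<partial>\<^sub>a - \<partial>\<^sub>b\<close>, \<open>T\<close>, \<open>\<sigma>\<close>, \<open>shy\<close>, \<open>chy\<close> are tanh, sech, sinh, cosh of \<open>xy/2\<close>; \<open>shu\<close>, \<open>chu\<close> are sinh and
  cosh of \<open>xu/2\<close>; \<open>\<Sigma>\<close>, \<open>TH\<close> are sech and tanh of \<open>x(u + y)/2\<close>; \<open>K\<close> is \<open>exp (x(\<partial>\<^sub>a + \<partial>\<^sub>b)/2)\<close>; and \<open>q\<close> is
  \<open>shy / x\<close>.  The left-hand side is what the product rule yields, one line for each of the
  five terms of the symbol.  The two facts that make it collapse are the addition theorem for tanh in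
  the form \<open>TH - T = \<sigma> \<Sigma> shu\<close>, and \<open>\<Sigma> (T shu + chu) = \<sigma>\<close>, by which the product rule for the
  fourth term cancels the derivative of the factor \<open>y\<close> in the third.
\<close>

lemma symbol1_ring_identity:
  fixes x y u c h T \<sigma> shy chy shu chu \<Sigma> TH K q :: "'a::idom"
  assumes "2 * h = 1" and "T = shy * \<sigma>" and "\<sigma> * chy = 1" and "\<Sigma> * (chy * chu + shy * shu) = 1"
    and "TH = \<Sigma> * (shy * chu + chy * shu)" and "q * x = shy" and "chy ^ 2 - shy ^ 2 = 1"
  shows "- (h * c)
     - (h * c * T + h * u * (x * - (h * c) * \<sigma>\<^sup>2))
     - h^2 * x * ((y * c - c * u) * \<sigma>\<^sup>2 + y * u * (2 * \<sigma> * (x * - (h * c) * - (\<sigma> * T))))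
     + (- (h * c) * \<sigma> * shu * \<Sigma> + h * y * (x * - (h * c) * - (\<sigma> * T)) * shu * \<Sigma> + h * y * \<sigma> * (x * (h * c) * chu) * \<Sigma>)
     - (- (h * c) * chy * K * \<Sigma> + q * (x * h * K) * \<Sigma>)
   = - (c * h * (1 + TH)) + c * u * (- (h^2) * x * (- 2 + x * y * T) * \<sigma>\<^sup>2) - h * K * \<Sigma> * (shy - c * chy)"
proof -
  have "\<sigma> * shy\<^sup>2 = chy - \<sigma>"
    using assms(3,7) by algebra
  moreover have "T = shy * \<sigma> * (\<Sigma> * (chy * chu + shy * shu))"
    using assms(2,4) by simp
  then have "T = (\<sigma> * chy) * shy * chu * \<Sigma> + (\<sigma> * shy\<^sup>2) * shu * \<Sigma>"
    by algebra
  ultimately have "T = shy * chu * \<Sigma> + (chy - \<sigma>) * shu * \<Sigma>"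
    using assms(3) by simp
  then have a: "TH = T + \<sigma> * shu * \<Sigma>"
    unfolding assms(5) by algebra
  have b: "\<sigma> * T * shu * \<Sigma> + \<sigma> * chu * \<Sigma> = \<sigma>\<^sup>2"
    using assms(2-4) by algebra
  \<comment> \<open>the factor \<open>x\<close> from differentiating \<open>K\<close> cancels the division by \<open>x\<close> in \<open>q\<close>\<close>
  have e: "q * (x * h * K) * \<Sigma> = shy * h * K * \<Sigma>"
    by (simp add: mult_ac flip: assms(6))
  have d: "h\<^sup>2 * x * (y * u * (2 * \<sigma> * (x * - (h * c) * - (\<sigma> * T)))) = h\<^sup>2 * x\<^sup>2 * y * u * c * \<sigma>\<^sup>2 * T"
    using assms(1) by algebra
  show ?thesis
    using b d e unfolding a by algebra
qed

text \<open>
  Both derivations that occur below satisfy these assumptions, with \<open>c = 1\<close> for \<open>d/d\<partial>\<^sub>a - d/dy\<close> and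
  \<open>c = -1\<close> for \<open>d/d\<partial>\<^sub>b + d/dy\<close>.  They annihilate \<open>\<partial>\<^sub>a - \<partial>\<^sub>b + y\<close>, so that
  \<open>sech (x(\<partial>\<^sub>a - \<partial>\<^sub>b + y)/2)\<close> behaves as a constant.
\<close>

lemma derivation_symbol1:
  assumes d: "derivation d" and const: "\<And>r. d (yC r) = 0"
    and dy: "d yY = - c" and du: "d yDa - d yDb = c" and dv: "d yDa + d yDb = 1"
  shows "fps_map d symbol1 =
    - (fps_const c * fps_half * (1 + tanh_x (yC (1/2) * (yDa - yDb + yY))))
    + fps_const (c * (yDa - yDb)) * symbol3
    - fps_half * exp_x (yC (1/2) * (yDa + yDb)) * sech_x (yC (1/2) * (yDa - yDb + yY))
        * (sinh_x (yC (1/2) * yY) - fps_const c * cosh_x (yC (1/2) * yY))"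
proof -
  define D where "D = fps_map d"
  have D: "derivation D"
    unfolding D_def by (rule derivation_fps_map[OF d])
  note dm = derivation_mult[OF d] derivation_add[OF d] derivation_diff[OF d]
  note Dm = derivation_mult[OF D]
  define u where "u = yDa - yDb"
  define w where "w = yC (1/2) * (u + yY)"
  have d_half: "d (yC (1/2) * p) = yC (1/2) * d p" for p
    by (simp add: dm const)
  have d_u: "d u = c" and d_w: "d w = 0"
    unfolding u_def w_def by (simp_all add: dm const du dy)
  have Dx: "D (at_x F p) = fps_X * fps_const (d p) * at_x (fps_deriv F) p" for F p
    unfolding D_def by (rule fps_map_at_x[OF d const])
  have DC: "D (fps_const p) = fps_const (d p)" for p
    unfolding D_def by (rule fps_map_const) (simp add: d)
  have DX: "D fps_X = 0"
    unfolding D_def by (rule fps_map_fps_X[OF d])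
  define T where "T = tanh_x (yC (1/2) * yY)"
  define \<sigma> where "\<sigma> = sech_x (yC (1/2) * yY)"
  define shy where "shy = sinh_x (yC (1/2) * yY)"
  define chy where "chy = cosh_x (yC (1/2) * yY)"
  define shu where "shu = sinh_x (yC (1/2) * u)"
  define chu where "chu = cosh_x (yC (1/2) * u)"
  define \<Sigma> where "\<Sigma> = sech_x w"
  define TH where "TH = tanh_x w"
  define K where "K = exp_x (yC (1/2) * (yDa + yDb))"
  define q where "q = fps_shift 1 shy"
  define h where "h = fps_half"
  define C where "C = fps_const c"
  define Y where "Y = fps_const yY"
  define U where "U = fps_const u"
  have quarter: "fps_const (yC (1/4)) = h\<^sup>2"
    by (simp add: h_def power2_eq_square flip: yC_mult)
  have "fps_nth shy 0 = 0"
    by (simp add: shy_def fps_sinh_def yC_0)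
  then have qX: "q * fps_X = shy"
    unfolding q_def by (auto simp: fps_eq_iff)
  have w_add: "w = yC (1/2) * yY + yC (1/2) * u"
    by (simp add: w_def algebra_simps)
  have "D T = fps_X * - (h * C) * \<sigma>\<^sup>2" "D \<sigma> = fps_X * - (h * C) * - (\<sigma> * T)"
    "D shy = fps_X * - (h * C) * chy" "D shu = fps_X * (h * C) * chu"
    "D \<Sigma> = 0" "D K = fps_X * h * K" "D h = 0" "D C = fps_const (d c)"
    "D Y = - C" "D U = C"
    unfolding T_def \<sigma>_def shy_def chy_def shu_def chu_def \<Sigma>_def K_def h_def C_def Y_def U_def
    by (simp_all add: Dx DC d_half d_u d_w dy dm dv const fps_deriv_tanh fps_deriv_sech fps_deriv_sinh
        at_x_mult at_x_minus power2_eq_square flip: fps_const_neg)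
  note DD = this
  have "D q = fps_shift 1 (D shy)"
    by (simp add: D_def q_def fps_map_fps_shift)
  also have "D shy = - (h * C) * chy * fps_X"
    unfolding DD by (simp only: mult_ac)
  finally have Dq: "D q = - (h * C) * chy"
    by (simp only: fps_shift_times_fps_X')
  have symbol1: "symbol1 = h * Y - h * U * T - h\<^sup>2 * fps_X * (Y * U) * \<sigma>\<^sup>2 + h * Y * \<sigma> * shu * \<Sigma> - q * K * \<Sigma>"
    unfolding symbol1_def by (simp add: T_def \<sigma>_def shu_def \<Sigma>_def w_def q_def shy_def K_def Y_def U_def h_def
       quarter[unfolded h_def] u_def flip: fps_const_mult)
  have "D symbol1 = - (h * C) - (h * C * T + h * U * (fps_X * - (h * C) * \<sigma>\<^sup>2))
     - h\<^sup>2 * fps_X * ((Y * C - C * U) * \<sigma>\<^sup>2 + Y * U * (2 * \<sigma> * (fps_X * - (h * C) * - (\<sigma> * T))))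
     + (- (h * C) * \<sigma> * shu * \<Sigma> + h * Y * (fps_X * - (h * C) * - (\<sigma> * T)) * shu * \<Sigma> + h * Y * \<sigma> * (fps_X * (h * C) * chu) * \<Sigma>)
     - (- (h * C) * chy * K * \<Sigma> + q * (fps_X * h * K) * \<Sigma>)"
    unfolding symbol1
    by (simp add: Dm derivation_add[OF D] derivation_diff[OF D] DD Dq DX power2_eq_square algebra_simps)
  also have "\<dots> = - (C * h * (1 + TH)) + C * U * (- (h^2) * fps_X * (- 2 + fps_X * Y * T) * \<sigma>\<^sup>2) - h * K * \<Sigma> * (shy - C * chy)"
  proof (rule symbol1_ring_identity)
    show "2 * h = 1"
      unfolding h_def by (rule fps_half_double)
    show "T = shy * \<sigma>"
      unfolding T_def shy_def \<sigma>_def by (rule tanh_x_eq)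
    show "\<sigma> * chy = 1"
      unfolding chy_def \<sigma>_def by (rule sech_x_cosh_x)
    show "\<Sigma> * (chy * chu + shy * shu) = 1"
      unfolding \<Sigma>_def w_add chy_def shy_def chu_def shu_def cosh_x_add[symmetric] by (rule sech_x_cosh_x)
    show "TH = \<Sigma> * (shy * chu + chy * shu)"
      unfolding TH_def \<Sigma>_def w_add chy_def shy_def chu_def shu_def sinh_x_add[symmetric]
      by (simp add: tanh_x_eq)
    show "q * fps_X = shy"
      by (rule qX)
    show "chy\<^sup>2 - shy\<^sup>2 = 1"
      unfolding chy_def shy_def by (rule cosh_x_sinh_x)
  qed
  also have "- (h^2) * fps_X * (- 2 + fps_X * Y * T) * \<sigma>\<^sup>2 = symbol3"
    unfolding symbol3_def by (simp add: quarter T_def \<sigma>_def Y_def)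
  finally show ?thesis
    unfolding D_def C_def U_def h_def TH_def \<Sigma>_def w_def u_def K_def shy_def chy_def by simp
qed

lemma half_add: "yC (1/2) * p + yC (1/2) * p = p"
  by (simp add: yC_1 flip: distrib_right yC_add)

text \<open>
  With \<open>w = (\<partial>\<^sub>a - \<partial>\<^sub>b + y)/2\<close> and \<open>(\<partial>\<^sub>a + \<partial>\<^sub>b)/2 = \<partial>\<^sub>a - w + y/2\<close>, the last term of \<open>derivation_symbol1\<close>
  becomes a multiple of \<open>exp (x(\<partial>\<^sub>a - w)) sech (x w)\<close>.  The tanh that is split off is the symbol of
  \<open>\<D>\<^sub>2\<close>, with \<open>\<partial>\<^sub>b - \<partial>\<^sub>a\<close> for \<open>\<partial>\<^sub>b\<close>.
\<close>

lemma symbol1_da_minus_dy: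
  assumes d: "derivation d" and const: "\<And>r. d (yC r) = 0"
    and "d yY = - 1" and "d yDa = 1" and "d yDb = 0"
  shows "fps_map d symbol1 =
    (exp_x yDa - 1) * (1 - fps_half * at_x fps_euler (yDb - yDa - yY))
    - tanh_x (yC (1/2) * (yY - (yDb - yDa))) - fps_const (yDb - yDa) * symbol3"
proof -
  define w where "w = yC (1/2) * (yDa - yDb + yY)"
  have "yC (1/2) * (yDa + yDb) = yDa + - w + yC (1/2) * yY"
    using half_add[of yDa] unfolding w_def by (simp add: algebra_simps)
  then have K: "exp_x (yC (1/2) * (yDa + yDb)) = exp_x yDa * exp_x (- w) * exp_x (yC (1/2) * yY)"
    by (simp only: at_x_exp_add)
  have w2: "yDb - yDa - yY = - (w + w)"
    unfolding w_def half_add by simp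
  have w3: "yC (1/2) * (yY - (yDb - yDa)) = w"
    by (simp add: w_def algebra_simps)
  have sc: "sinh_x p - cosh_x p = - exp_x (- p)" for p
    using fps_half_double unfolding cosh_x_eq sinh_x_eq by algebra
  have t: "1 - fps_half * (exp_x w * sech_x w) = fps_half * exp_x (- w) * sech_x w"
    and t': "fps_half * (1 + tanh_x w) = tanh_x w + fps_half * exp_x (- w) * sech_x w"
    using fps_half_double sech_x_cosh_x[of w] unfolding tanh_x_eq cosh_x_eq sinh_x_eq by algebra+
  have "fps_map d symbol1 = - (fps_half * (1 + tanh_x w)) + fps_const (yDa - yDb) * symbol3
     - fps_half * (exp_x yDa * exp_x (- w) * exp_x (yC (1/2) * yY)) * sech_x w * (- exp_x (- (yC (1/2) * yY)))"
    using derivation_symbol1[OF d const, of 1] assms(3-) by (simp add: sc K flip: w_def)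
  also have "\<dots> = (exp_x yDa - 1) * (fps_half * exp_x (- w) * sech_x w) - tanh_x w
      + fps_const (yDa - yDb) * symbol3"
    unfolding t' using exp_x_minus[of "yC (1/2) * yY"] by algebra
  also have "fps_const (yDa - yDb) * symbol3 = - (fps_const (yDb - yDa) * symbol3)"
    by (simp add: algebra_simps flip: fps_const_sub)
  finally show ?thesis
    unfolding w2 w3 euler_x_eq t by simp
qed

text \<open>
  Now \<open>(\<partial>\<^sub>a + \<partial>\<^sub>b)/2 = \<partial>\<^sub>b + w - y/2\<close>, and \<open>c = -1\<close> turns the last factor into
  \<open>sinh (xy/2) + cosh (xy/2) = exp (xy/2)\<close>.
\<close>

lemma symbol1_dy_plus_db:
  assumes d: "derivation d" and const: "\<And>r. d (yC r) = 0"
    and "d yY = 1" and "d yDa = 0" and "d yDb = 1"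
  shows "fps_map d symbol1 =
    - ((exp_x yDb - 1) * (fps_half * at_x fps_euler (- (yDa - yDb) - yY)))
    - fps_const (yDa - yDb) * symbol3"
proof -
  define w where "w = yC (1/2) * (yDa - yDb + yY)"
  have "yC (1/2) * (yDa + yDb) = yDb + w + - (yC (1/2) * yY)"
    using half_add[of yDb] unfolding w_def by (simp add: algebra_simps)
  then have K: "exp_x (yC (1/2) * (yDa + yDb)) = exp_x yDb * exp_x w * exp_x (- (yC (1/2) * yY))"
    by (simp only: at_x_exp_add)
  have w2: "- (yDa - yDb) - yY = - (w + w)"
    unfolding w_def half_add by simp
  have m1: "fps_const (- 1 :: ypoly) = - 1"
    by (metis fps_const_neg fps_const_1_eq_1)
  have p: "d yY = - (- 1)" "d yDa - d yDb = - 1" "d yDa + d yDb = 1"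
    using assms by simp_all
  have sc: "sinh_x p + cosh_x p = exp_x p" for p
    using fps_half_double unfolding cosh_x_eq sinh_x_eq by algebra
  have t': "fps_half * (1 + tanh_x w) = fps_half * exp_x w * sech_x w"
    using fps_half_double sech_x_cosh_x[of w] unfolding tanh_x_eq cosh_x_eq sinh_x_eq by algebra
  have "fps_map d symbol1 = fps_half * (1 + tanh_x w) - fps_const (yDa - yDb) * symbol3
     - fps_half * (exp_x yDb * exp_x w * exp_x (- (yC (1/2) * yY))) * sech_x w * exp_x (yC (1/2) * yY)"
    using derivation_symbol1[OF d const p, folded w_def, unfolded K fps_const_mult[symmetric] m1]
      sc[of "yC (1/2) * yY"] by algebra
  also have "\<dots> = - ((exp_x yDb - 1) * (fps_half * (exp_x w * sech_x w)))
      - fps_const (yDa - yDb) * symbol3"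
    unfolding t' using exp_x_minus[of "yC (1/2) * yY"] by algebra
  finally show ?thesis
    unfolding w2 euler_x_eq by simp
qed

section \<open>The formal Laplace transform\<close>

abbreviation dC :: "real \<Rightarrow> dpoly" where "dC r \<equiv> [:[:r:]:]"
abbreviation dDa :: dpoly where "dDa \<equiv> [:0, 1:]"
abbreviation dDb :: dpoly where "dDb \<equiv> [:[:0, 1:]:]"

lemma laplace_poly_bound:
  assumes "degree h \<le> N"
  shows "laplace_poly s h = (\<Sum>n\<le>N. dC (fact n / s ^ (n + 1)) * coeff h n)"
  unfolding laplace_poly_def
  by (rule sum.mono_neutral_left) (use assms in \<open>auto simp: coeff_eq_0\<close>)

lemma laplace_poly_add: "laplace_poly s (h + k) = laplace_poly s h + laplace_poly s k"
proof -
  define N where "N = max (degree h) (degree k)"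
  have "degree h \<le> N" "degree k \<le> N" "degree (h + k) \<le> N"
    by (auto simp: N_def intro: degree_add_le)
  then show ?thesis
    by (simp add: laplace_poly_bound[of _ N] sum.distrib smult_add_right)
qed

lemma laplace_poly_const_mult: "laplace_poly s ([:c:] * h) = c * laplace_poly s h"
proof -
  have "degree ([:c:] * h) \<le> degree h"
    by (simp add: degree_smult_le)
  then have "laplace_poly s ([:c:] * h) = (\<Sum>n\<le>degree h. dC (fact n / s ^ (n + 1)) * coeff ([:c:] * h) n)"
    by (rule laplace_poly_bound)
  then show ?thesis
    by (simp add: laplace_poly_def sum_distrib_left)
qed

lemma laplace_poly_const: "laplace_poly s [:c:] = dC (1 / s) * c"
  by (simp add: laplace_poly_def)

lemma laplace_poly_0 [simp]: "laplace_poly s 0 = 0"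
  by (simp add: laplace_poly_def)

lemma laplace_poly_minus: "laplace_poly s (- h) = - laplace_poly s h"
  using laplace_poly_add[of s h "- h"] by (simp add: eq_neg_iff_add_eq_0 add.commute)

lemma laplace_poly_diff: "laplace_poly s (h - k) = laplace_poly s h - laplace_poly s k"
  using laplace_poly_add[of s h "- k"] by (simp add: laplace_poly_minus)

lemma laplace_poly_sum: "laplace_poly s (\<Sum>i\<in>A. h i) = (\<Sum>i\<in>A. laplace_poly s (h i))"
  by (induction A rule: infinite_finite_induct) (simp_all add: laplace_poly_add)

text \<open>Integration by parts.\<close>

lemma laplace_poly_pderiv:
  assumes "s \<noteq> 0"
  shows "dC s * laplace_poly s h = coeff h 0 + laplace_poly s (pderiv h)"
proof -
  have fact: "dC s * (dC (fact (Suc n) / s ^ (Suc n + 1)) * c) = dC (fact n / s ^ (n + 1)) * (of_nat (Suc n) * c)" for n c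
  proof -
    have "dC s * dC (fact (Suc n) / s ^ (Suc n + 1)) = dC (fact n / s ^ (n + 1)) * of_nat (Suc n)"
    proof -
      have "of_nat (Suc n) = dC (real (Suc n))"
        by (simp only: of_nat_poly)
      moreover have "s * (fact (Suc n) / s ^ (Suc n + 1)) = fact n / s ^ (n + 1) * real (Suc n)"
        using assms by (simp add: field_simps)
      moreover have "dC r * dC t = dC (r * t)" for r t
        by simp
      ultimately show ?thesis
        by (simp only:)
    qed
    then show ?thesis
      by (simp only: mult.assoc[symmetric])
  qed
  have "dC s * laplace_poly s h = (\<Sum>n\<le>Suc (degree h). dC s * (dC (fact n / s ^ (n + 1)) * coeff h n))"
    by (simp only: laplace_poly_bound[of h "Suc (degree h)"] le_SucI order.refl sum_distrib_left)
  also have "\<dots> = coeff h 0 + (\<Sum>n\<le>degree h. dC s * (dC (fact (Suc n) / s ^ (Suc n + 1)) * coeff h (Suc n)))"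
    using assms by (subst sum.atMost_Suc_shift) (simp add: one_pCons[symmetric] del: sum.atMost_Suc)
  also have "\<dots> = coeff h 0 + (\<Sum>n\<le>degree h. dC (fact n / s ^ (n + 1)) * coeff (pderiv h) n)"
    by (simp only: fact coeff_pderiv)
  also have "\<dots> = coeff h 0 + laplace_poly s (pderiv h)"
    by (subst laplace_poly_bound[of _ "degree h"]) (auto simp: degree_pderiv)
  finally show ?thesis .
qed

lemma laplace_poly_derivation:
  assumes "derivation d" and "\<And>r. d (dC r) = 0"
  shows "d (laplace_poly s h) = laplace_poly s (map_poly d h)"
proof -
  have "degree (map_poly d h) \<le> degree h"
    using assms(1) by (intro degree_le) (simp add: coeff_map_poly coeff_eq_0)
  then show ?thesis
    using assms(1) by (simp add: laplace_poly_bound[of _ "degree h"] derivation_sum derivation_mult assms(2) coeff_map_poly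
        del: mult_pCons_left)
qed

section \<open>Differential operators with constant coefficients\<close>

lemma poly_act_0 [simp]: "poly_act 0 g = (\<lambda>a b. 0)"
  by (simp add: poly_act_def fun_eq_iff)

lemma pda_pdb_power:
  assumes "smooth2 g"
  shows "pda ((pdb ^^ j) g) = (pdb ^^ j) (pda g)" and "smooth2 ((pdb ^^ j) g)"
  using assms by (induction j) (simp_all add: pda_pdb_commute smooth2_pdb)

text \<open>
  Operators in \<open>\<partial>\<^sub>b\<close> alone.  A separate constant for them lets the recursion of \<open>poly_act\<close> over the outer
  coefficients, \<open>poly_act_pCons\<close>, terminate as a rewrite rule.
\<close>

definition db_act :: "real poly \<Rightarrow> (real \<Rightarrow> real \<Rightarrow> real) \<Rightarrow> real \<Rightarrow> real \<Rightarrow> real" where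
  "db_act c = poly_act [:c:]"

lemma db_act_0 [simp]: "db_act 0 g = (\<lambda>a b. 0)"
  by (simp add: db_act_def)

lemma poly_act_pCons:
  assumes "smooth2 g"
  shows "poly_act (pCons c P) g = (\<lambda>a b. db_act c g a b + poly_act P (pda g) a b)"
proof (cases "P = 0")
  case False
  then show ?thesis
    unfolding poly_act_def db_act_def
    by (simp add: sum.atMost_Suc_shift funpow_Suc_right pda_pdb_power[OF assms] del: funpow.simps sum.atMost_Suc)
qed (simp add: db_act_def)

lemma db_act_pCons: "db_act (pCons r c) g = (\<lambda>a b. r * g a b + db_act c (pdb g) a b)"
  unfolding db_act_def poly_act_def
  by (cases "c = 0") (simp_all add: sum.atMost_Suc_shift funpow_swap1 del: sum.atMost_Suc)

lemma smooth2_db_act: "smooth2 g \<Longrightarrow> smooth2 (db_act c g)"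
  by (induction c arbitrary: g) (auto simp: db_act_pCons intro!: smooth2_intros smooth2_pdb)

lemma smooth2_poly_act: "smooth2 g \<Longrightarrow> smooth2 (poly_act P g)"
  by (induction P arbitrary: g)
    (auto simp: poly_act_pCons intro!: smooth2_intros smooth2_pda smooth2_db_act)

lemma db_act_add: "smooth2 g \<Longrightarrow>
    db_act (c + d) g = (\<lambda>a b. db_act c g a b + db_act d g a b)"
  by (induction c d arbitrary: g rule: poly_induct2)
    (auto simp: db_act_pCons smooth2_pdb algebra_simps)

lemma poly_act_add: "smooth2 g \<Longrightarrow>
    poly_act (P + Q) g = (\<lambda>a b. poly_act P g a b + poly_act Q g a b)"
  by (induction P Q arbitrary: g rule: poly_induct2)
    (auto simp: poly_act_pCons db_act_add smooth2_pda algebra_simps)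

lemma db_act_fun_add: "smooth2 g \<Longrightarrow> smooth2 h \<Longrightarrow>
    db_act c (\<lambda>a b. g a b + h a b) = (\<lambda>a b. db_act c g a b + db_act c h a b)"
  by (induction c arbitrary: g h)
    (auto simp: db_act_pCons pd_add smooth2_pdb algebra_simps)

lemma poly_act_fun_add: "smooth2 g \<Longrightarrow> smooth2 h \<Longrightarrow>
    poly_act P (\<lambda>a b. g a b + h a b) = (\<lambda>a b. poly_act P g a b + poly_act P h a b)"
  by (induction P arbitrary: g h)
    (auto simp: poly_act_pCons db_act_fun_add pd_add smooth2_pda smooth2_intros algebra_simps)

lemma poly_act_dC_mult: "poly_act (dC r * P) g = (\<lambda>a b. r * poly_act P g a b)"
  by (cases "r = 0") (simp_all add: poly_act_def fun_eq_iff sum_distrib_left mult.assoc)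

lemma db_act_pd:
  assumes "smooth2 g"
  shows "db_act c (pda g) = pda (db_act c g)" and "db_act c (pdb g) = pdb (db_act c g)"
proof -
  have "db_act c (pda g) = pda (db_act c g) \<and> db_act c (pdb g) = pdb (db_act c g)"
    using assms
  proof (induction c arbitrary: g)
    case (pCons r c)
    have "pda (\<lambda>a b. r * g a b) = (\<lambda>a b. r * pda g a b)" "pdb (\<lambda>a b. r * g a b) = (\<lambda>a b. r * pdb g a b)"
      by (intro pda_eqI pdb_eqI DERIV_cmult DERIV_pda DERIV_pdb pCons.prems)+
    then show ?case
      using pCons by (simp add: db_act_pCons pd_add smooth2_intros smooth2_pdb smooth2_pda
          smooth2_db_act pda_pdb_commute)
  qed (auto intro!: pda_eqI[symmetric] pdb_eqI[symmetric])
  then show "db_act c (pda g) = pda (db_act c g)" "db_act c (pdb g) = pdb (db_act c g)"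
    by simp_all
qed

lemma poly_act_pd:
  assumes "smooth2 g"
  shows "poly_act P (pda g) = pda (poly_act P g)" and "poly_act P (pdb g) = pdb (poly_act P g)"
  using assms
  by (induction P arbitrary: g)
    (auto simp: poly_act_pCons db_act_pd pd_add smooth2_poly_act smooth2_db_act smooth2_pda smooth2_pdb
      pda_pdb_commute[symmetric] intro!: pda_eqI[symmetric] pdb_eqI[symmetric])

lemma poly_act_dDb_mult: "smooth2 g \<Longrightarrow> poly_act (dDb * P) g = poly_act P (pdb g)"
proof (induction P arbitrary: g)
  case (pCons c P)
  have "dDb * pCons c P = pCons (pCons 0 c) (dDb * P)"
    by simp
  then show ?case
    using pCons by (simp only: poly_act_pCons smooth2_pda smooth2_pdb db_act_pCons pda_pdb_commute) simp
qed simp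

lemma poly_act_dDa_mult: "smooth2 g \<Longrightarrow> poly_act (dDa * P) g = poly_act P (pda g)"
  by (simp add: poly_act_pCons)

lemma poly_act_const_mult: "smooth2 g \<Longrightarrow> poly_act ([:c:] * P) g = db_act c (poly_act P g)"
proof (induction c arbitrary: g)
  case (pCons r c)
  have "[:pCons r c:] * P = dC r * P + dDb * ([:c:] * P)"
  proof -
    have "[:pCons r c:] = dC r + dDb * [:c:]"
      by simp
    then show ?thesis
      by (simp only: distrib_right mult.assoc)
  qed
  then show ?case
    using pCons by (simp only: poly_act_add poly_act_dC_mult poly_act_dDb_mult db_act_pCons
        smooth2_pdb poly_act_pd db_act_pd smooth2_poly_act)
qed simp

text \<open>
  Products of symbols act by composition; this uses that \<open>\<partial>\<^sub>a\<close> and \<open>\<partial>\<^sub>b\<close> commute on smooth functions.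
\<close>

lemma poly_act_mult: "smooth2 g \<Longrightarrow> poly_act (P * Q) g = poly_act P (poly_act Q g)"
proof (induction P arbitrary: g)
  case (pCons c P)
  have "pCons c P * Q = [:c:] * Q + dDa * (P * Q)"
    by simp
  then show ?case
    using pCons by (simp only: poly_act_add poly_act_const_mult poly_act_dDa_mult poly_act_pCons
        smooth2_pda poly_act_pd smooth2_poly_act)
qed simp

lemma poly_act_dDa_power: "smooth2 g \<Longrightarrow> poly_act (dDa ^ m) g = (pda ^^ m) g"
  and poly_act_dDb_power: "smooth2 g \<Longrightarrow> poly_act (dDb ^ m) g = (pdb ^^ m) g"
proof -
  have 1: "poly_act 1 g = g" for g
    by (simp add: one_pCons poly_act_def fun_eq_iff)
  show "smooth2 g \<Longrightarrow> poly_act (dDa ^ m) g = (pda ^^ m) g"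
    by (induction m arbitrary: g)
      (simp_all only: 1 power_0 power_Suc poly_act_dDa_mult smooth2_pda funpow_Suc_right o_def funpow.simps(1) id_apply)
  show "smooth2 g \<Longrightarrow> poly_act (dDb ^ m) g = (pdb ^^ m) g"
    by (induction m arbitrary: g)
      (simp_all only: 1 power_0 power_Suc poly_act_dDb_mult smooth2_pdb funpow_Suc_right o_def funpow.simps(1) id_apply)
qed

text \<open>
  The commutator of an operator with multiplication by a coordinate is the formal derivative of its
  symbol.
\<close>

lemma poly_act_times_fst: "smooth2 g \<Longrightarrow>
    poly_act P (\<lambda>a b. a * g a b) = (\<lambda>a b. a * poly_act P g a b + poly_act (pderiv P) g a b)"
proof (induction P arbitrary: g)
  case (pCons c P)
  have c: "smooth2 g \<Longrightarrow> db_act c (\<lambda>a b. a * g a b) = (\<lambda>a b. a * db_act c g a b)" for c g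
  proof (induction c arbitrary: g)
    case (pCons r c)
    have "pdb (\<lambda>a b. a * g a b) = (\<lambda>a b. a * pdb g a b)"
      by (intro pdb_eqI DERIV_cmult DERIV_pdb pCons.prems)
    with pCons show ?case
      by (simp add: db_act_pCons smooth2_pdb algebra_simps)
  qed simp
  have "pda (\<lambda>a b. a * g a b) = (\<lambda>a b. g a b + a * pda g a b)"
    by (rule pda_eqI) (use DERIV_pda[OF pCons.prems] in \<open>auto intro!: derivative_eq_intros\<close>)
  with pCons show ?case
    by (simp add: poly_act_pCons c smooth2_intros smooth2_pda poly_act_fun_add pderiv_pCons poly_act_add algebra_simps)
qed simp

lemma poly_act_times_snd: "smooth2 g \<Longrightarrow>
    poly_act P (\<lambda>a b. b * g a b) = (\<lambda>a b. b * poly_act P g a b + poly_act (map_poly pderiv P) g a b)"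
proof (induction P arbitrary: g)
  case (pCons c P)
  have c: "smooth2 g \<Longrightarrow> db_act c (\<lambda>a b. b * g a b) =
      (\<lambda>a b. b * db_act c g a b + db_act (pderiv c) g a b)" for c g
  proof (induction c arbitrary: g)
    case (pCons r c)
    have "pdb (\<lambda>a b. b * g a b) = (\<lambda>a b. g a b + b * pdb g a b)"
      by (rule pdb_eqI) (use DERIV_pdb[OF pCons.prems] in \<open>auto intro!: derivative_eq_intros\<close>)
    with pCons show ?case
      by (simp add: db_act_pCons smooth2_pdb smooth2_intros db_act_fun_add
          pderiv_pCons db_act_add algebra_simps)
  qed simp
  have "pda (\<lambda>a b. b * g a b) = (\<lambda>a b. b * pda g a b)"
    by (intro pda_eqI DERIV_cmult DERIV_pda pCons.prems)
  with pCons show ?case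
    by (simp add: poly_act_pCons c smooth2_intros smooth2_pda map_poly_pCons algebra_simps)
qed simp

section \<open>Linear substitutions\<close>

text \<open>
  A relation closed under the ring operations plays the part of a ring homomorphism here: it lifts
  to polynomials and power series coefficient by coefficient, and a symbol is transformed by
  transforming the generators in it.
\<close>

definition ring_rel :: "('a::comm_ring_1 \<Rightarrow> 'a \<Rightarrow> bool) \<Rightarrow> bool" where
  "ring_rel R \<longleftrightarrow> R 0 0 \<and> R 1 1 \<and> (\<forall>x x' y y'. R x x' \<longrightarrow> R y y' \<longrightarrow>
     R (x + y) (x' + y') \<and> R (x - y) (x' - y') \<and> R (x * y) (x' * y'))"

lemma ring_relD:
  assumes "ring_rel R"
  shows "R 0 0" "R 1 1"
    and "R x x' \<Longrightarrow> R y y' \<Longrightarrow> R (x + y) (x' + y')"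
    and "R x x' \<Longrightarrow> R y y' \<Longrightarrow> R (x - y) (x' - y')"
    and "R x x' \<Longrightarrow> R y y' \<Longrightarrow> R (x * y) (x' * y')"
  using assms by (auto simp: ring_rel_def)

lemma ring_rel_sum: "ring_rel R \<Longrightarrow> (\<And>i. i \<in> A \<Longrightarrow> R (g i) (g' i)) \<Longrightarrow> R (\<Sum>i\<in>A. g i) (\<Sum>i\<in>A. g' i)"
  by (induction A rule: infinite_finite_induct) (auto intro: ring_relD)

lemma ring_rel_uminus: "ring_rel R \<Longrightarrow> R x x' \<Longrightarrow> R (- x) (- x')"
  using ring_relD(4)[of R 0 0 x x'] by (simp add: ring_relD)

lemma ring_rel_2: "ring_rel R \<Longrightarrow> R 2 2"
  using ring_relD(3)[of R 1 1 1 1] by (simp add: ring_relD)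

lemma ring_rel_power: "ring_rel R \<Longrightarrow> R x x' \<Longrightarrow> R (x ^ n) (x' ^ n)"
  by (induction n) (auto intro: ring_relD)

definition poly_rel :: "('a::zero \<Rightarrow> 'a \<Rightarrow> bool) \<Rightarrow> 'a poly \<Rightarrow> 'a poly \<Rightarrow> bool" where
  "poly_rel R P Q \<longleftrightarrow> (\<forall>n. R (coeff P n) (coeff Q n))"

definition fps_rel :: "('a \<Rightarrow> 'a \<Rightarrow> bool) \<Rightarrow> 'a fps \<Rightarrow> 'a fps \<Rightarrow> bool" where
  "fps_rel R F G \<longleftrightarrow> (\<forall>n. R (fps_nth F n) (fps_nth G n))"

lemma ring_rel_poly_rel: "ring_rel R \<Longrightarrow> ring_rel (poly_rel R)"
  unfolding ring_rel_def[of "poly_rel R"] poly_rel_def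
  by (auto simp: coeff_mult coeff_1 intro: ring_relD ring_rel_sum)

lemma ring_rel_fps_rel: "ring_rel R \<Longrightarrow> ring_rel (fps_rel R)"
  unfolding ring_rel_def[of "fps_rel R"] fps_rel_def
  by (auto simp: fps_mult_nth intro: ring_relD ring_rel_sum)

lemma fps_rel_const: "ring_rel R \<Longrightarrow> R x y \<Longrightarrow> fps_rel R (fps_const x) (fps_const y)"
  by (auto simp: fps_rel_def intro: ring_relD)

lemma fps_rel_X: "ring_rel R \<Longrightarrow> fps_rel R fps_X fps_X"
  by (auto simp: fps_rel_def fps_X_def intro: ring_relD)

lemma poly_act_dC: "poly_act (dC c) g = (\<lambda>a b. c * g a b)"
  by (simp add: poly_act_def fun_eq_iff)

text \<open>
  \<open>Q\<close> is the operator that \<open>P\<close> becomes when it is moved past the substitution.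
\<close>

definition subst_rel :: "real \<Rightarrow> real \<Rightarrow> real \<Rightarrow> real \<Rightarrow> dpoly \<Rightarrow> dpoly \<Rightarrow> bool" where
  "subst_rel p q r w P Q \<longleftrightarrow>
    (\<forall>g. smooth2 g \<longrightarrow> poly_act P (lin_subst p q r w g) = lin_subst p q r w (poly_act Q g))"

lemma poly_act_diff: "smooth2 g \<Longrightarrow> poly_act (P - Q) g = (\<lambda>a b. poly_act P g a b - poly_act Q g a b)"
  using poly_act_add[of g "P - Q" Q] by (auto simp: fun_eq_iff)

lemma ring_rel_subst_rel: "ring_rel (subst_rel p q r w)"
  unfolding ring_rel_def subst_rel_def
  by (auto simp: poly_act_add poly_act_diff poly_act_mult smooth2_intros smooth2_poly_act
      one_pCons poly_act_dC) (auto simp: lin_subst_def)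

lemma subst_rel_dC: "subst_rel p q r w (dC c) (dC c)"
  by (simp add: subst_rel_def poly_act_dC) (simp add: lin_subst_def)

text \<open>The chain rule, on the generators of the ring of operators.\<close>

lemma subst_rel_dDa: "subst_rel p q r w dDa (dC p * dDa + dC r * dDb)"
  and subst_rel_dDb: "subst_rel p q r w dDb (dC q * dDa + dC w * dDb)"
proof -
  have 1: "poly_act dDa g = pda g" "poly_act dDb g = pdb g" if "smooth2 g" for g
    using poly_act_dDa_power[OF that, of 1] poly_act_dDb_power[OF that, of 1] by simp_all
  show "subst_rel p q r w dDa (dC p * dDa + dC r * dDb)" "subst_rel p q r w dDb (dC q * dDa + dC w * dDb)"
    unfolding subst_rel_def
    by (auto simp only: 1 smooth2_intros pd_lin_subst poly_act_add poly_act_dC_mult) (auto simp: lin_subst_def)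
qed

abbreviation subst_rel_y :: "real \<Rightarrow> real \<Rightarrow> real \<Rightarrow> real \<Rightarrow> ypoly \<Rightarrow> ypoly \<Rightarrow> bool" where
  "subst_rel_y p q r w \<equiv> poly_rel (subst_rel p q r w)"

abbreviation subst_rel_x :: "real \<Rightarrow> real \<Rightarrow> real \<Rightarrow> real \<Rightarrow> ypoly fps \<Rightarrow> ypoly fps \<Rightarrow> bool" where
  "subst_rel_x p q r w \<equiv> fps_rel (subst_rel_y p q r w)"

lemma ring_rel_subst_rel_y: "ring_rel (subst_rel_y p q r w)"
  by (intro ring_rel_poly_rel ring_rel_subst_rel)

lemma ring_rel_subst_rel_x: "ring_rel (subst_rel_x p q r w)"
  by (intro ring_rel_fps_rel ring_rel_subst_rel_y)

lemma poly_rel_const: "ring_rel R \<Longrightarrow> R x y \<Longrightarrow> poly_rel R [:x:] [:y:]"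
  by (auto simp: poly_rel_def coeff_pCons split: nat.splits intro: ring_relD)

lemma subst_rel_y_generators:
  "subst_rel_y p q r w yY yY"
  "subst_rel_y p q r w (yC c) (yC c)"
  "subst_rel_y p q r w yDa (yC p * yDa + yC r * yDb)"
  "subst_rel_y p q r w yDb (yC q * yDa + yC w * yDb)"
proof -
  have "subst_rel p q r w 0 0" "subst_rel p q r w 1 1"
    by (rule ring_relD[OF ring_rel_subst_rel])+
  then show "subst_rel_y p q r w yY yY"
    by (auto simp: poly_rel_def yY_def coeff_pCons split: nat.splits)
  show "subst_rel_y p q r w (yC c) (yC c)"
    unfolding yC_def by (rule poly_rel_const[OF ring_rel_subst_rel subst_rel_dC])
  have "[:dC u * dDa + dC v * dDb:] = yC u * yDa + yC v * yDb" for u v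
    by (simp add: yC_def yDa_def yDb_def)
  then show "subst_rel_y p q r w yDa (yC p * yDa + yC r * yDb)"
    "subst_rel_y p q r w yDb (yC q * yDa + yC w * yDb)"
    using poly_rel_const[OF ring_rel_subst_rel subst_rel_dDa, of p q r w]
      poly_rel_const[OF ring_rel_subst_rel subst_rel_dDb, of p q r w]
    by (simp_all only: yDa_def[symmetric] yDb_def[symmetric])
qed

lemma subst_rel_x_at_x:
  "subst_rel_y p q r w P Q \<Longrightarrow> subst_rel_x p q r w (at_x F P) (at_x F Q)"
  by (simp add: fps_rel_def ring_relD[OF ring_rel_subst_rel_y] subst_rel_y_generators
      ring_rel_power[OF ring_rel_subst_rel_y])

lemmas subst_rel_intros =
  ring_rel_uminus[OF ring_rel_subst_rel_y] ring_rel_uminus[OF ring_rel_subst_rel_x]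
  ring_rel_2[OF ring_rel_subst_rel_x]
  ring_relD[OF ring_rel_subst_rel_y] ring_relD[OF ring_rel_subst_rel_x]
  ring_rel_power[OF ring_rel_subst_rel_y] ring_rel_power[OF ring_rel_subst_rel_x]
  subst_rel_x_at_x fps_rel_const[OF ring_rel_subst_rel_y] fps_rel_X[OF ring_rel_subst_rel_y]
  subst_rel_y_generators(1,2)

lemma subst_rel_laplace_poly:
  assumes "subst_rel_y p q r w h k"
  shows "subst_rel p q r w (laplace_poly s h) (laplace_poly s k)"
proof -
  define N where "N = max (degree h) (degree k)"
  have "laplace_poly s h = (\<Sum>n\<le>N. dC (fact n / s ^ (n + 1)) * coeff h n)"
    "laplace_poly s k = (\<Sum>n\<le>N. dC (fact n / s ^ (n + 1)) * coeff k n)"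
    by (intro laplace_poly_bound; simp add: N_def)+
  then show ?thesis
    using assms unfolding poly_rel_def
    by (simp only:)
      (blast intro: ring_rel_sum[OF ring_rel_subst_rel] ring_relD(5)[OF ring_rel_subst_rel] subst_rel_dC)
qed

section \<open>The terms of the identity as Laplace transforms\<close>

text \<open>
  The common shape of all terms: \<open>s \<L>\<^sub>y{F}(s) \<circ> g\<close> at \<open>(a, b)\<close>.  The parameter \<open>s\<close> of the transform
  is independent of the point, which is \<open>(0, -s)\<close> in half of the cases.
\<close>

definition lap_at :: "real \<Rightarrow> (real \<Rightarrow> real \<Rightarrow> real) \<Rightarrow> real \<Rightarrow> real \<Rightarrow> ypoly fps \<Rightarrow> real fps" where
  "lap_at s g a b F = Abs_fps (\<lambda>n. s * poly_act (laplace_poly s (fps_nth F n)) g a b)"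

lemma lap_at_nth [simp]: "fps_nth (lap_at s g a b F) n = s * poly_act (laplace_poly s (fps_nth F n)) g a b"
  by (simp add: lap_at_def)

lemma lap_at_add: "smooth2 g \<Longrightarrow> lap_at s g a b (F + G) = lap_at s g a b F + lap_at s g a b G"
  and lap_at_diff: "smooth2 g \<Longrightarrow> lap_at s g a b (F - G) = lap_at s g a b F - lap_at s g a b G"
  by (simp_all add: fps_eq_iff laplace_poly_add laplace_poly_diff poly_act_add poly_act_diff algebra_simps)

lemma lap_at_lin_subst:
  assumes "smooth2 g" and "subst_rel_x p q r w F G"
  shows "lap_at s (lin_subst p q r w g) a b F = lap_at s g (p * a + q * b) (r * a + w * b) G"
proof -
  have "subst_rel p q r w (laplace_poly s (fps_nth F n)) (laplace_poly s (fps_nth G n))" for n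
    using assms(2) by (intro subst_rel_laplace_poly) (simp add: fps_rel_def)
  then show ?thesis
    using assms(1) by (simp add: fps_eq_iff subst_rel_def lin_subst_def)
qed

lemma poly_act_zero [simp]: "poly_act P (\<lambda>u v. 0) = (\<lambda>a b. 0)"
proof -
  have "pda (\<lambda>u v. 0) = (\<lambda>u v. 0)" "pdb (\<lambda>u v. 0) = (\<lambda>u v. 0)"
    by (simp_all add: pda_def pdb_def)
  then have "(pda ^^ i) ((pdb ^^ j) (\<lambda>u v. 0)) = (\<lambda>u v. 0)" for i j
    by (induction i; induction j; simp)
  then show ?thesis
    by (simp add: poly_act_def fun_eq_iff)
qed

text \<open>
  Only the top summand of the convolution in \<open>act\<close> contributes, as the operand is constant in \<open>x\<close>.
\<close>

lemma act_const_eq_lap_at: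
  "act (fps_const (dC s) * laplace s F) (\<lambda>u v. fps_const (h u v)) a b = lap_at s h a b F"
proof (rule fps_ext)
  fix n :: nat
  have "{..n} = insert n {..<n}"
    by auto
  then show "fps_nth (act (fps_const (dC s) * laplace s F) (\<lambda>u v. fps_const (h u v)) a b) n =
      fps_nth (lap_at s h a b F) n"
    by (simp add: act_def laplace_def poly_act_dC_mult del: mult_pCons_left)
qed

lemma pda_power: "(pda ^^ n) f a b = (deriv ^^ n) (\<lambda>t. f t b) a"
  by (induction n arbitrary: a) (simp_all add: pda_def)

lemma taylor_eq_lap_at:
  assumes "smooth2 f" "s \<noteq> 0"
  shows "taylor (\<lambda>x. f x s) - fps_const (f 0 s) = lap_at s f 0 s (exp_x yDa - 1)"
proof (rule fps_ext)
  fix n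
  have "fps_nth (exp_x yDa) n = [:dC (1 / fact n) * dDa ^ n:]"
    by (simp add: yC_def yDa_def poly_const_pow)
  then have L: "s * poly_act (laplace_poly s (fps_nth (exp_x yDa) n)) f 0 s = (pda ^^ n) f 0 s / fact n"
    using assms by (simp only: laplace_poly_const poly_act_dC_mult poly_act_dDa_power) simp
  show "fps_nth (taylor (\<lambda>x. f x s) - fps_const (f 0 s)) n = fps_nth (lap_at s f 0 s (exp_x yDa - 1)) n"
  proof (cases n)
    case 0
    then show ?thesis
      by (simp add: taylor_def yC_1)
  next
    case (Suc m)
    then show ?thesis
      using L by (simp add: taylor_def pda_power del: funpow.simps)
  qed
qed

text \<open>
  Integration by parts for \<open>(\<partial>\<^sub>b - y)\<^sup>k\<^sup>+\<^sup>1\<close>.  It has the shape of the Leibniz rule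
  \<open>v D\<^sup>k\<^sup>+\<^sup>1 h + (k+1) D\<^sup>k h = D\<^sup>k\<^sup>+\<^sup>1 (v h)\<close>, and this agreement proves the next lemma.
\<close>

lemma laplace_poly_shift_power_Suc:
  assumes "v \<noteq> 0"
  shows "dC v * laplace_poly v ((yDb - yY) ^ Suc k) =
    dDb ^ Suc k - dC (real (Suc k)) * laplace_poly v ((yDb - yY) ^ k)"
proof -
  have "coeff ((yDb - yY) ^ Suc k) 0 = dDb ^ Suc k"
    by (simp add: poly_0_coeff_0[symmetric] poly_power yDb_def yY_def del: power_Suc)
  moreover have "pderiv (yDb - yY) = - 1"
    by (simp add: yDb_def yY_def pderiv_diff pderiv_pCons one_pCons)
  then have "pderiv ((yDb - yY) ^ Suc k) = - ([:of_nat (Suc k):] * (yDb - yY) ^ k)"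
    by (simp add: pderiv_power_Suc del: of_nat_Suc power_Suc)
  moreover have "(of_nat (Suc k) :: dpoly) = dC (real (Suc k))"
    by (simp only: of_nat_poly)
  ultimately show ?thesis
    by (simp only: laplace_poly_pderiv[OF assms] laplace_poly_minus laplace_poly_const_mult)
qed

text \<open>
  The rule \<open>\<partial>\<^sub>b\<^sup>k \<circ> (W/b) = \<L>\<^sub>y{(\<partial>\<^sub>b - y)\<^sup>k} \<circ> W\<close>, formally from \<open>1/b = \<integral> exp (-b y) dy\<close>.  In the proof, the
  right-hand sides \<open>q k\<close> satisfy \<open>b q (k+1) = \<partial>\<^sub>b\<^sup>k\<^sup>+\<^sup>1 W - (k+1) q k\<close>.  If \<open>q k\<close> is a quotient \<open>N/b\<close>, then its
  derivative is \<open>(N' - q k)/b\<close>, which is \<open>q (k+1)\<close> by this recursion; so the \<open>q k\<close> are the successive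
  derivatives of \<open>q 0 = W/b\<close> away from \<open>0\<close>.
\<close>

lemma pdb_power_divide:
  assumes W: "smooth2 W" and "v \<noteq> 0"
  shows "(pdb ^^ k) (\<lambda>u v. W u v / v) u v = poly_act (laplace_poly v ((yDb - yY) ^ k)) W u v"
proof -
  define q where "q k v = poly_act (laplace_poly v ((yDb - yY) ^ k)) W u v" for k v
  have q0: "q 0 v = W u v / v" for v
    using laplace_poly_const[of v 1] by (simp add: q_def one_pCons poly_act_dC)
  have qSuc: "q (Suc k) v = ((pdb ^^ Suc k) W u v - real (Suc k) * q k v) / v" if "v \<noteq> 0" for k v
  proof -
    have "v * q (Suc k) v = poly_act (dC v * laplace_poly v ((yDb - yY) ^ Suc k)) W u v"
      by (simp only: q_def poly_act_dC_mult)
    also have "\<dots> = (pdb ^^ Suc k) W u v - real (Suc k) * q k v"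
      by (simp only: laplace_poly_shift_power_Suc[OF that] poly_act_diff[OF W] poly_act_dC_mult
          poly_act_dDb_power[OF W] q_def)
    finally show ?thesis
      using that by (simp add: field_simps)
  qed
  have quotient: "((\<lambda>t. q k t) has_real_derivative q (Suc k) v) (at v)"
    if N: "(N has_real_derivative N') (at v)" and q: "\<And>t. t \<noteq> 0 \<Longrightarrow> q k t = N t / t"
      and N': "N' - q k v = v * q (Suc k) v" and v: "v \<noteq> 0" for N N' k v
  proof -
    have "((\<lambda>t. N t / t) has_real_derivative (N' * v - N v * 1) / (v * v)) (at v)"
      by (intro DERIV_divide N DERIV_ident v)
    also have "(N' * v - N v * 1) / (v * v) = (N' - q k v) / v"
      using v by (simp add: q[OF v] field_simps)
    also have "\<dots> = q (Suc k) v"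
      using v N' by simp
    finally show ?thesis
      by (rule has_field_derivative_transform_within_open[where S = "- {0}"]) (use v q in auto)
  qed
  have pdb_W: "((\<lambda>t. (pdb ^^ k) W u t) has_real_derivative (pdb ^^ Suc k) W u v) (at v)" for k v
    using DERIV_pdb[OF pda_pdb_power(2)[OF W], of k u v] by simp
  have q: "((\<lambda>t. q k t) has_real_derivative q (Suc k) v) (at v)" if "v \<noteq> 0" for k v
    using that
  proof (induction k arbitrary: v)
    case 0
    show ?case
      by (rule quotient[OF DERIV_pdb[OF W] _ _ 0]) (use 0 in \<open>simp_all add: q0 qSuc\<close>)
  next
    case (Suc k)
    show ?case
    proof (rule quotient[OF _ _ _ Suc.prems])
      show "((\<lambda>t. (pdb ^^ Suc k) W u t - real (Suc k) * q k t) has_real_derivative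
        (pdb ^^ Suc (Suc k)) W u v - real (Suc k) * q (Suc k) v) (at v)"
        by (intro DERIV_diff DERIV_cmult pdb_W Suc)
    qed (use Suc.prems in \<open>simp_all add: qSuc field_simps\<close>)
  qed
  have "(pdb ^^ k) (\<lambda>u v. W u v / v) u v = q k v"
    using \<open>v \<noteq> 0\<close>
  proof (induction k arbitrary: v)
    case (Suc k)
    have "eventually (\<lambda>t. t \<in> - {0}) (nhds v)"
      using Suc.prems by (intro eventually_nhds_in_open) auto
    then have "eventually (\<lambda>t. (pdb ^^ k) (\<lambda>u v. W u v / v) u t = q k t) (nhds v)"
      by eventually_elim (use Suc.IH in simp)
    then have "deriv ((pdb ^^ k) (\<lambda>u v. W u v / v) u) v = deriv (q k) v"
      by (intro deriv_cong_ev) auto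
    also have "\<dots> = q (Suc k) v"
      by (rule DERIV_imp_deriv) (rule q[OF Suc.prems])
    finally show ?case
      by (simp add: pdb_def[where g = "(pdb ^^ k) (\<lambda>u v. W u v / v)"])
  qed (simp add: q0)
  then show ?thesis
    by (simp add: q_def)
qed

lemma euler_op_nth:
  "fps_nth (euler_op s g) n =
    (\<Sum>k\<le>n. s * fps_nth fps_euler k * (pdb ^^ k) (\<lambda>u v. fps_nth (g v) (n - k)) 0 s)"
proof -
  have monom: "poly_act [:monom c k:] h = (\<lambda>a b. c * (pdb ^^ k) h a b)" for c k h
    by (cases "c = 0") (simp_all add: poly_act_def fun_eq_iff degree_monom_eq if_distrib[of "\<lambda>x. x * _"] cong: if_cong)
  have "dDb ^ k = [:monom 1 k:]" for k
    by (simp add: poly_const_pow monom_altdef)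
  then have "dC s * (dC (euler_poly k 0 / fact k) * dDb ^ k) = [:monom (s * fps_nth fps_euler k) k:]" for k
    by (simp add: smult_monom euler_poly_def fps_euler_def)
  then show ?thesis
    by (simp add: euler_op_def act_b_def act_def monom del: mult_pCons_left)
qed

lemma poly_act_cmult:
  assumes "smooth2 h"
  shows "poly_act P (\<lambda>a b. c * h a b) = (\<lambda>a b. c * poly_act P h a b)"
proof -
  have "poly_act P (\<lambda>a b. c * h a b) = poly_act (P * dC c) h"
    by (simp only: poly_act_mult[OF assms] poly_act_dC)
  also have "\<dots> = poly_act (dC c * P) h"
    by (simp only: mult.commute)
  finally show ?thesis
    by (simp only: poly_act_dC_mult)
qed

lemma lap_at_euler_nth:
  assumes "smooth2 f"
  shows "fps_nth (lap_at s f a b (at_x fps_euler p * (fps_half * (exp_x yDa - 1)))) n =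
    (\<Sum>k\<le>n. s * fps_nth fps_euler k * (if n - k = 0 then 0 else
       1 / (2 * fact (n - k)) * poly_act (laplace_poly s (p ^ k)) ((pda ^^ (n - k)) f) a b))"
proof -
  have G: "fps_nth (fps_half * (exp_x yDa - 1)) m =
      (if m = 0 then 0 else [:dC (1 / (2 * fact m)) * dDa ^ m:])" for m
    by (auto simp: yC_def yDa_def poly_const_pow one_pCons)
  have sum: "poly_act (\<Sum>k\<in>A. P k) f a b = (\<Sum>k\<in>A. poly_act (P k) f a b)" for A :: "nat set" and P
    by (induction A rule: infinite_finite_induct) (simp_all add: poly_act_add[OF assms])
  have "poly_act (laplace_poly s (fps_nth (at_x fps_euler p) k * fps_nth (fps_half * (exp_x yDa - 1)) m)) f a b =
      fps_nth fps_euler k * (if m = 0 then 0 else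
       1 / (2 * fact m) * poly_act (laplace_poly s (p ^ k)) ((pda ^^ m) f) a b)" for k m
  proof (cases "m = 0")
    case False
    have "fps_nth (at_x fps_euler p) k * fps_nth (fps_half * (exp_x yDa - 1)) m =
       [:dC (fps_nth fps_euler k):] * ([:dC (1 / (2 * fact m)) * dDa ^ m:] * p ^ k)"
      unfolding G using False by (simp add: yC_def)
    then show ?thesis
      using False by (simp only: laplace_poly_const_mult poly_act_dC_mult mult.assoc if_False)
        (simp only: mult.commute[of "dDa ^ m"] poly_act_mult[OF assms] poly_act_dDa_power[OF assms])
  qed (simp add: yC_1)
  then show ?thesis
    by (simp only: lap_at_nth fps_mult_nth[of "at_x fps_euler p"] atLeast0AtMost laplace_poly_sum sum
        sum_distrib_left mult.assoc)
qed

lemma smooth2_pda_power: "smooth2 f \<Longrightarrow> smooth2 ((pda ^^ m) f)"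
  by (induction m) (simp_all add: smooth2_pda)

text \<open>
  The constant coefficient of the operand cancels, hence the factor \<open>exp (x \<partial>\<^sub>a) - 1\<close>.  For the part
  \<open>f(x,-b)\<close> the derivative \<open>\<partial>\<^sub>b\<close> becomes \<open>-\<partial>\<^sub>b\<close> at the point \<open>(0, -s)\<close>.
\<close>

lemma euler_op_eq_lap_at:
  assumes f: "smooth2 f" and s: "s \<noteq> 0"
  shows "euler_op s (\<lambda>b.
         - fps_const (1 / (2 * b)) * (taylor (\<lambda>x. f x (- b)) + taylor (\<lambda>x. f x b))
         + fps_const ((f 0 (- b) + f 0 b) / (2 * b))) =
    - lap_at s f 0 s (at_x fps_euler (yDb - yY) * (fps_half * (exp_x yDa - 1)))
    - lap_at s f 0 (- s) (at_x fps_euler (- yDb - yY) * (fps_half * (exp_x yDa - 1)))"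
proof (rule fps_ext)
  fix n
  define g where "g b = - fps_const (1 / (2 * b)) * (taylor (\<lambda>x. f x (- b)) + taylor (\<lambda>x. f x b))
         + fps_const ((f 0 (- b) + f 0 b) / (2 * b))" for b
  define W where "W m = (\<lambda>a b. (- 1 / (2 * fact m)) * (lin_subst 0 0 0 1 ((pda ^^ m) f) a b
     + lin_subst 0 0 0 (- 1) ((pda ^^ m) f) a b))" for m
  have g0: "fps_nth (g v) 0 = 0" for v
    by (cases "v = 0") (simp_all add: g_def taylor_def field_simps)
  have gm: "fps_nth (g v) m = W m u v / v" if "m \<noteq> 0" for m u v
    using that by (cases "v = 0") (simp_all add: g_def W_def taylor_def lin_subst_def pda_power field_simps)
  have smooth: "smooth2 (lin_subst p q r w ((pda ^^ m) f))" for p q r w m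
    by (intro smooth2_intros smooth2_pda_power f)
  have "subst_rel_y 0 0 0 w ((yDb - yY) ^ k) ((yC 0 * yDa + yC w * yDb - yY) ^ k)" for w k
    by (intro subst_rel_intros subst_rel_y_generators)
  then have rel: "subst_rel 0 0 0 w (laplace_poly s ((yDb - yY) ^ k)) (laplace_poly s ((yC w * yDb - yY) ^ k))" for w k
    using subst_rel_laplace_poly by (simp add: yC_0)
  have pdb_power: "(pdb ^^ k) (\<lambda>u v. fps_nth (g v) m) 0 s =
     (if m = 0 then 0 else - 1 / (2 * fact m) *
      (poly_act (laplace_poly s ((yDb - yY) ^ k)) ((pda ^^ m) f) 0 s +
       poly_act (laplace_poly s ((- yDb - yY) ^ k)) ((pda ^^ m) f) 0 (- s)))" for k m
  proof (cases "m = 0")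
    case True
    have "(pdb ^^ k) (\<lambda>u v. 0) = (\<lambda>u v. 0)"
      by (induction k) (auto intro: pdb_eqI)
    then show ?thesis
      using True by (simp add: g0)
  next
    case False
    then have "(\<lambda>u v. fps_nth (g v) m) = (\<lambda>u v. W m u v / v)"
      using gm by blast
    moreover have "smooth2 (W m)"
      unfolding W_def by (intro smooth2_intros smooth)
    moreover define c :: real where "c = - 1 / (2 * fact m)"
    have "poly_act (laplace_poly s ((yDb - yY) ^ k)) (W m) 0 s = c *
      (poly_act (laplace_poly s ((yDb - yY) ^ k)) ((pda ^^ m) f) 0 s +
       poly_act (laplace_poly s ((- yDb - yY) ^ k)) ((pda ^^ m) f) 0 (- s))"
      unfolding W_def c_def[symmetric] using rel[of 1 k] rel[of "- 1" k] smooth2_pda_power[OF f]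
      by (simp add: poly_act_cmult poly_act_fun_add smooth smooth2_intros subst_rel_def yC_1 yC_minus)
        (simp add: lin_subst_def)
    ultimately show ?thesis
      unfolding c_def using False pdb_power_divide[OF _ s, of "W m" k 0] by simp
  qed
  show "fps_nth (euler_op s g) n =
    fps_nth (- lap_at s f 0 s (at_x fps_euler (yDb - yY) * (fps_half * (exp_x yDa - 1)))
      - lap_at s f 0 (- s) (at_x fps_euler (- yDb - yY) * (fps_half * (exp_x yDa - 1)))) n"
    unfolding euler_op_nth pdb_power fps_sub_nth fps_neg_nth lap_at_euler_nth[OF f]
    by (simp only: sum_negf[symmetric] sum_subtractf[symmetric])
      (intro sum.cong, auto simp: algebra_simps)
qed

text \<open>
  Every term of the symbol has a factor \<open>y\<close>, \<open>tanh (xy/2)\<close> or \<open>sinh (xy/2)\<close>, and series all of whose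
  coefficients vanish at \<open>y = 0\<close> form an ideal.  Therefore integration by parts produces no boundary
  term for this symbol.
\<close>

lemma coeff_symbol1_0: "coeff (fps_nth symbol1 n) 0 = 0"
proof -
  define V where "V F \<longleftrightarrow> (\<forall>n. coeff (fps_nth F n) 0 = 0)" for F :: "ypoly fps"
  have V_mult: "V (F * G)" if "V F \<or> V G" for F G
    using that by (auto simp: V_def fps_mult_nth coeff_sum coeff_mult intro!: sum.neutral)
  have V_Y: "V (fps_const (p * yY))" "V (fps_const (yY * p))" for p
    by (auto simp: V_def coeff_mult yY_def)
  have V_at_x: "V (at_x F (yC (1/2) * yY))" if "fps_nth F 0 = 0" for F
    unfolding V_def
  proof
    fix n
    show "coeff (fps_nth (at_x F (yC (1/2) * yY)) n) 0 = 0"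
      using that by (cases n) (simp_all add: yC_0 coeff_mult yY_def)
  qed
  have "fps_nth fps_sinh 0 = 0"
    by (simp add: fps_sinh_def)
  moreover from this have "fps_nth fps_tanh 0 = 0"
    by (simp add: fps_tanh_eq)
  moreover have "V F \<Longrightarrow> V (fps_shift 1 F)" "V F \<Longrightarrow> V G \<Longrightarrow> V (F + G)" "V F \<Longrightarrow> V G \<Longrightarrow> V (F - G)" for F G
    by (auto simp: V_def)
  ultimately have "V symbol1"
    unfolding symbol1_def by (simp add: V_mult V_at_x V_Y)
  then show ?thesis
    by (simp add: V_def)
qed

lemma derivations_dpoly:
  "derivation (pderiv :: dpoly \<Rightarrow> dpoly)" "derivation (map_poly pderiv :: dpoly \<Rightarrow> dpoly)"
  by (intro derivation_pderiv derivation_map_poly)+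

lemma derivations_dpoly_dC: "pderiv (dC r) = 0" "map_poly pderiv (dC r) = 0"
  by (simp_all add: pderiv_pCons map_poly_pCons)

text \<open>
  The derivation \<open>d/dy\<close> comes from \<open>s \<L>{h} = \<L>{h'}\<close>, applied to the factors \<open>b = s\<close> and \<open>a = -s\<close>; the
  derivations \<open>d/d\<partial>\<^sub>b\<close> and \<open>d/d\<partial>\<^sub>a\<close> come from commuting the operator with these factors.
\<close>

lemma D1_eq_lap_at:
  assumes f: "smooth2 f" and s: "s \<noteq> 0"
  shows "D1 s (\<lambda>a b. fps_const (b * f (a + b) a + a * f (a + b) b)) =
    lap_at s (lin_subst 1 1 0 1 f) (- s) s (fps_map (\<lambda>h. map_poly pderiv h - pderiv h) symbol1) +
    lap_at s (lin_subst 1 1 1 0 f) (- s) s (fps_map (\<lambda>h. pderiv h + map_poly (map_poly pderiv) h) symbol1)"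
proof (rule fps_ext)
  fix n
  define h where "h = fps_nth symbol1 n"
  define P where "P = laplace_poly s h"
  define g where "g = lin_subst 1 1 0 1 f"
  define g' where "g' = lin_subst 1 1 1 0 f"
  have smooth: "smooth2 g" "smooth2 g'"
    unfolding g_def g'_def by (intro smooth2_intros f)+
  have "dC s * P = laplace_poly s (pderiv h)"
    unfolding P_def laplace_poly_pderiv[OF s] by (simp add: h_def coeff_symbol1_0)
  then have sP: "s * poly_act P k a b = poly_act (laplace_poly s (pderiv h)) k a b" for k a b
    by (metis poly_act_dC_mult)
  have da: "pderiv P = laplace_poly s (map_poly pderiv h)"
    unfolding P_def by (rule laplace_poly_derivation; simp add: derivations_dpoly derivations_dpoly_dC)
  have db: "map_poly pderiv P = laplace_poly s (map_poly (map_poly pderiv) h)"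
    unfolding P_def by (rule laplace_poly_derivation; simp add: derivations_dpoly derivations_dpoly_dC)
  have "(\<lambda>a b. b * f (a + b) a + a * f (a + b) b) = (\<lambda>a b. b * g' a b + a * g a b)"
    by (simp add: g_def g'_def lin_subst_def)
  moreover have "poly_act P (\<lambda>a b. b * g' a b + a * g a b) (- s) s =
     (s * poly_act P g' (- s) s + poly_act (map_poly pderiv P) g' (- s) s) +
     (- s * poly_act P g (- s) s + poly_act (pderiv P) g (- s) s)"
    using smooth by (simp add: poly_act_fun_add smooth2_intros poly_act_times_fst poly_act_times_snd)
  moreover have "\<dots> = poly_act (laplace_poly s (pderiv h + map_poly (map_poly pderiv) h)) g' (- s) s +
      poly_act (laplace_poly s (map_poly pderiv h - pderiv h)) g (- s) s"
    by (simp add: da db sP smooth laplace_poly_add laplace_poly_diff poly_act_add poly_act_diff)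
  ultimately show "fps_nth (D1 s (\<lambda>a b. fps_const (b * f (a + b) a + a * f (a + b) b))) n =
     fps_nth (lap_at s (lin_subst 1 1 0 1 f) (- s) s (fps_map (\<lambda>h. map_poly pderiv h - pderiv h) symbol1) +
    lap_at s (lin_subst 1 1 1 0 f) (- s) s (fps_map (\<lambda>h. pderiv h + map_poly (map_poly pderiv) h) symbol1)) n"
    unfolding D1_def act_const_eq_lap_at
    by (simp add: P_def[symmetric] h_def[symmetric] g_def[symmetric] g'_def[symmetric] algebra_simps)
qed

lemma derivations_ypoly:
  "derivation (\<lambda>h :: ypoly. map_poly pderiv h - pderiv h)"
  "derivation (\<lambda>h :: ypoly. pderiv h + map_poly (map_poly pderiv) h)"
  by (intro derivation_combine derivation_pderiv derivation_map_poly)+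

lemma derivations_ypoly_generators:
  "map_poly pderiv (yC r) - pderiv (yC r) = 0"
  "map_poly pderiv yY - pderiv yY = - 1"
  "map_poly pderiv yDa - pderiv yDa = 1"
  "map_poly pderiv yDb - pderiv yDb = 0"
  "pderiv (yC r) + map_poly (map_poly pderiv) (yC r) = 0"
  "pderiv yY + map_poly (map_poly pderiv) yY = 1"
  "pderiv yDa + map_poly (map_poly pderiv) yDa = 0"
  "pderiv yDb + map_poly (map_poly pderiv) yDb = 1"
  by (simp_all add: yC_def yY_def yDa_def yDb_def pderiv_pCons map_poly_pCons one_pCons)

lemma symbol3_lin_subst: "subst_rel_x p q r w symbol3 symbol3"
  unfolding symbol3_def by (intro subst_rel_intros)

text \<open>
  On \<open>f(a+b,b)\<close> the operators \<open>\<partial>\<^sub>a\<close> and \<open>\<partial>\<^sub>b - \<partial>\<^sub>a\<close> are the partial derivatives of \<open>f\<close> in the first and the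
  second argument.
\<close>

lemma symbol1_da_lin_subst:
  "subst_rel_x 1 1 0 1 (fps_map (\<lambda>h. map_poly pderiv h - pderiv h) symbol1)
    ((exp_x yDa - 1) * (1 - fps_half * at_x fps_euler (yDb - yY))
      - symbol2 - fps_const yDb * symbol3)"
proof -
  have gens: "subst_rel_y 1 1 0 1 yDa yDa" "subst_rel_y 1 1 0 1 (yDb - yDa) yDb"
    using subst_rel_y_generators(3,4)[of 1 1 0 1]
      ring_relD(4)[OF ring_rel_subst_rel_y subst_rel_y_generators(4) subst_rel_y_generators(3), of 1 1 0 1]
    by (simp_all add: yC_0 yC_1)
  have "fps_map (\<lambda>h. map_poly pderiv h - pderiv h) symbol1 =
    (exp_x yDa - 1) * (1 - fps_half * at_x fps_euler (yDb - yDa - yY))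
    - tanh_x (yC (1/2) * (yY - (yDb - yDa))) - fps_const (yDb - yDa) * symbol3"
    by (rule symbol1_da_minus_dy[OF derivations_ypoly(1) derivations_ypoly_generators(1-4)])
  then show ?thesis
    unfolding symbol2_def by (simp only:) (intro subst_rel_intros gens symbol3_lin_subst)
qed

text \<open>On \<open>f(a+b,a)\<close> these are \<open>\<partial>\<^sub>b\<close> and \<open>\<partial>\<^sub>a - \<partial>\<^sub>b\<close>.\<close>

lemma symbol1_db_lin_subst:
  "subst_rel_x 1 1 1 0 (fps_map (\<lambda>h. pderiv h + map_poly (map_poly pderiv) h) symbol1)
    (- ((exp_x yDa - 1) * (fps_half * at_x fps_euler (- yDb - yY))) - fps_const yDb * symbol3)"
proof -
  have gens: "subst_rel_y 1 1 1 0 yDb yDa" "subst_rel_y 1 1 1 0 (yDa - yDb) yDb"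
    using subst_rel_y_generators(3,4)[of 1 1 1 0]
      ring_relD(4)[OF ring_rel_subst_rel_y subst_rel_y_generators(3) subst_rel_y_generators(4), of 1 1 1 0]
    by (simp_all add: yC_0 yC_1)
  have "fps_map (\<lambda>h. pderiv h + map_poly (map_poly pderiv) h) symbol1 =
    - ((exp_x yDb - 1) * (fps_half * at_x fps_euler (- (yDa - yDb) - yY)))
    - fps_const (yDa - yDb) * symbol3"
    by (rule symbol1_dy_plus_db[OF derivations_ypoly(2) derivations_ypoly_generators(5-8)])
  then show ?thesis
    by (simp only:) (intro subst_rel_intros gens symbol3_lin_subst)
qed

lemma D2_eq_lap_at:
  assumes f: "smooth2 f"
  shows "D2 s (\<lambda>b. fps_const (f 0 b)) = lap_at s f 0 s symbol2"
proof -
  have "subst_rel_y 0 0 0 1 yDb yDb"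
    using subst_rel_y_generators(4)[of 0 0 0 1] by (simp add: yC_0 yC_1)
  then have "subst_rel_x 0 0 0 1 symbol2 symbol2"
    unfolding symbol2_def by (intro subst_rel_intros)
  then have "lap_at s (lin_subst 0 0 0 1 f) 0 s symbol2 = lap_at s f 0 s symbol2"
    by (subst lap_at_lin_subst[OF f]) simp_all
  then show ?thesis
    unfolding D2_def act_b_def act_const_eq_lap_at by (simp add: lin_subst_def)
qed

lemma lap_at_yDb_mult:
  assumes f: "smooth2 f"
  shows "lap_at s f a b (fps_const yDb * F) = lap_at s (pdb f) a b F"
proof -
  have "laplace_poly s (yDb * h) = dDb * laplace_poly s h" for h
    unfolding yDb_def by (rule laplace_poly_const_mult)
  then show ?thesis
    by (simp add: fps_eq_iff poly_act_dDb_mult[OF f] del: mult_pCons_left)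
qed

lemma D3_eq_lap_at:
  assumes f: "smooth2 f"
  shows "D3 s (\<lambda>b. fps_const (deriv (\<lambda>t. f 0 t - f 0 (- t)) b)) =
    lap_at s f 0 s (fps_const yDb * symbol3) + lap_at s f 0 (- s) (fps_const yDb * symbol3)"
proof -
  have "deriv (\<lambda>t. f 0 t - f 0 (- t)) b = pdb f 0 b + pdb f 0 (- b)" for b
  proof (rule DERIV_imp_deriv)
    have "((\<lambda>t. f 0 (- t)) has_real_derivative - pdb f 0 (- b)) (at b)"
      using DERIV_smooth2_affine[OF f, of 0 0 "- 1" 0 b] by simp
    then show "((\<lambda>t. f 0 t - f 0 (- t)) has_real_derivative pdb f 0 b + pdb f 0 (- b)) (at b)"
      using DERIV_diff[OF DERIV_pdb[OF f, of 0 b]] by fastforce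
  qed
  then have "(\<lambda>a b. deriv (\<lambda>t. f 0 t - f 0 (- t)) b) =
      (\<lambda>a b. lin_subst 0 0 0 1 (pdb f) a b + lin_subst 0 0 0 (- 1) (pdb f) a b)"
    by (simp add: lin_subst_def)
  moreover have "lap_at s (\<lambda>a b. lin_subst 0 0 0 1 (pdb f) a b + lin_subst 0 0 0 (- 1) (pdb f) a b) 0 s symbol3 =
      lap_at s (lin_subst 0 0 0 1 (pdb f)) 0 s symbol3 + lap_at s (lin_subst 0 0 0 (- 1) (pdb f)) 0 s symbol3"
    by (simp add: fps_eq_iff poly_act_fun_add smooth2_intros smooth2_pdb[OF f] algebra_simps)
  moreover have "\<dots> = lap_at s (pdb f) 0 s symbol3 + lap_at s (pdb f) 0 (- s) symbol3"
    by (subst (1 2) lap_at_lin_subst[OF smooth2_pdb[OF f] symbol3_lin_subst]) simp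
  ultimately show ?thesis
    unfolding D3_def act_b_def act_const_eq_lap_at lap_at_yDb_mult[OF f] by metis
qed

theorem theorem5:
  fixes f :: "real \<Rightarrow> real \<Rightarrow> real" and s :: real
  assumes "smooth2 f" and "s \<noteq> 0"
  shows
    "(taylor (\<lambda>x. f x s) - fps_const (f 0 s))
     + euler_op s (\<lambda>b.
         - fps_const (1 / (2 * b)) * (taylor (\<lambda>x. f x (- b)) + taylor (\<lambda>x. f x b))
         + fps_const ((f 0 (- b) + f 0 b) / (2 * b)))
     = D1 s (\<lambda>a b. fps_const (b * f (a + b) a + a * f (a + b) b))
       + D2 s (\<lambda>b. fps_const (f 0 b))
       + D3 s (\<lambda>b. fps_const (deriv (\<lambda>t. f 0 t - f 0 (- t)) b))"
proof -
  define A where "A = exp_x yDa - 1"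
  define E where "E = at_x fps_euler (yDb - yY)"
  define E' where "E' = at_x fps_euler (- yDb - yY)"
  define S where "S = fps_const yDb * symbol3"
  note lin = lap_at_add[OF assms(1)] lap_at_diff[OF assms(1)]
  have D1: "D1 s (\<lambda>a b. fps_const (b * f (a + b) a + a * f (a + b) b)) =
     lap_at s f 0 s (A * (1 - fps_half * E) - symbol2 - S) +
     lap_at s f 0 (- s) (- (A * (fps_half * E')) - S)"
    unfolding D1_eq_lap_at[OF assms] lap_at_lin_subst[OF assms(1) symbol1_da_lin_subst]
      lap_at_lin_subst[OF assms(1) symbol1_db_lin_subst]
    by (simp add: A_def E_def E'_def S_def)
  have "A * (1 - fps_half * E) = A - E * (fps_half * A)" "- (A * (fps_half * E')) = 0 - E' * (fps_half * A)"
    by (simp_all add: algebra_simps)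
  moreover have "lap_at s f 0 (- s) 0 = 0"
    by (simp add: fps_eq_iff)
  ultimately have "D1 s (\<lambda>a b. fps_const (b * f (a + b) a + a * f (a + b) b)) =
     lap_at s f 0 s A - lap_at s f 0 s (E * (fps_half * A)) - lap_at s f 0 s symbol2 - lap_at s f 0 s S
     - lap_at s f 0 (- s) (E' * (fps_half * A)) - lap_at s f 0 (- s) S"
    unfolding D1 by (simp only: lin) simp
  then show ?thesis
    unfolding taylor_eq_lap_at[OF assms] euler_op_eq_lap_at[OF assms] D2_eq_lap_at[OF assms(1)]
      D3_eq_lap_at[OF assms(1)]
    by (simp add: A_def E_def E'_def S_def)
qed

end
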